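(* Let $r\ge 1$ be an integer and let $G=E_2\times C_3^r$. There is no product-one-free sequence $S$ over $G$ satisfying \[ |S|=2r+11,\qquad |S\cap Z(G)|=2r-1 . \]
   Context: $E_2$ denotes the extraspecial group of order $3^5$ and exponent three; $C_3$ is the cyclic group of order three; $Z(G)$ is the center of $G$. A sequence over a finite group is an unordered finite list of group elements with repetitions allowed; subsequences are selections of indexed occurrences. A nonempty subsequence is product-one if its terms can be ordered so that their product is the identity. A sequence is product-one-free if it has no nonempty product-one subsequence. $|S|$ is the length of $S$ (counted with multiplicity), and $|S\cap Z(G)|$ is the number of terms of $S$, counted with multiplicity, lying in $Z(G)$. *)

theory Defs
  imports "HOL-Algebra.Algebra"
begin

definition center :: "('a, 'm) monoid_scheme \<Rightarrow> 'a set"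
  where "center G = {z \<in> carrier G. \<forall>g \<in> carrier G. z \<otimes>\<^bsub>G\<^esub> g = g \<otimes>\<^bsub>G\<^esub> z}"

definition elementary_abelian :: "nat \<Rightarrow> ('a, 'm) monoid_scheme \<Rightarrow> bool"
  where "elementary_abelian p G \<longleftrightarrow>
    comm_group G \<and> (\<forall>x \<in> carrier G. x [^]\<^bsub>G\<^esub> p = \<one>\<^bsub>G\<^esub>)"

definition extraspecial :: "nat \<Rightarrow> ('a, 'm) monoid_scheme \<Rightarrow> bool"
  where "extraspecial p G \<longleftrightarrow>
    Factorial_Ring.prime p \<and> group G \<and> (\<exists>n. order G = p ^ n) \<and> card (center G) = p \<and>
    elementary_abelian p (G Mod center G) \<and> \<not> trivial_group (G Mod center G)"

text \<open>Only meaningful for groups of finite exponent, in particular for finite groups.\<close>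

definition group_exponent :: "('a, 'm) monoid_scheme \<Rightarrow> nat"
  where "group_exponent G = (LEAST n. n > 0 \<and> (\<forall>x \<in> carrier G. x [^]\<^bsub>G\<^esub> n = \<one>\<^bsub>G\<^esub>))"

text \<open>Up to isomorphism there is exactly one group satisfying the following predicate;
  it plays the role of \<open>E\<^sub>2\<close>.\<close>

definition is_E2 :: "('a, 'm) monoid_scheme \<Rightarrow> bool"
  where "is_E2 E \<longleftrightarrow> extraspecial 3 E \<and> order E = 3 ^ 5 \<and> group_exponent E = 3"

definition C3_power :: "nat \<Rightarrow> (nat \<Rightarrow> int) monoid"
  where "C3_power r = product_group {..<r} (\<lambda>_. integer_mod_group 3)"

text \<open>Sequences over \<open>G\<close> are finite multisets of elements of \<open>G\<close>. A selection of indexed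
  occurrences is then a submultiset \<open>T \<subseteq># S\<close>.\<close>

definition sequence_over :: "('a, 'm) monoid_scheme \<Rightarrow> 'a multiset \<Rightarrow> bool"
  where "sequence_over G S \<longleftrightarrow> set_mset S \<subseteq> carrier G"

definition product_one :: "('a, 'm) monoid_scheme \<Rightarrow> 'a multiset \<Rightarrow> bool"
  where "product_one G T \<longleftrightarrow> (\<exists>xs. mset xs = T \<and> foldr (\<otimes>\<^bsub>G\<^esub>) xs \<one>\<^bsub>G\<^esub> = \<one>\<^bsub>G\<^esub>)"

definition product_one_free :: "('a, 'm) monoid_scheme \<Rightarrow> 'a multiset \<Rightarrow> bool"
  where "product_one_free G S \<longleftrightarrow> \<not> (\<exists>T. T \<subseteq># S \<and> T \<noteq> {#} \<and> product_one G T)"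

end

theory Submission
  imports Defs
begin

text \<open>
  The idea is to pass to an abelian group, to count subsets there modulo three, and to find that
  a product-one-free sequence would force the same alternating sum to be both \<open>-1\<close> and \<open>0\<close>.

  \<^bold>\<open>Abelian model.\<close> The quotient of \<open>E\<close> by its center is a space \<open>V\<close> of dimension four over the
  field with three elements; commutators define a nondegenerate alternating form \<open>\<omega>\<close> on it. If
  \<open>v\<close> is the projection to \<open>V\<close> and \<open>cp e\<close> is the \<open>e\<close>-th power of a fixed generator of \<open>Z(E)\<close>,
  then \<open>x y = y x cp(\<omega>(v x, v y))\<close>. The operation \<open>x y cp(\<omega>(v x, v y))\<close> makes the carrier of \<open>G\<close>
  an abelian group of exponent three and order \<open>3 ^ (r + 5)\<close>. A product of given terms in a
  given order is their product in this abelian group multiplied by \<open>cp(- e)\<close>, where \<open>e\<close>, the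
  value of the ordering, is the sum of \<open>\<omega>\<close> over all pairs of terms taken in that order. A set of
  terms thus is product-one iff its abelian product is \<open>cp e\<close> for some value \<open>e\<close> that is
  attained by an ordering.

  \<^bold>\<open>Alternating sums.\<close> As the length \<open>2 r + 11\<close> is \<open>2 (r + 5) + 1\<close>, an argument of Olson
  (\<open>signed_subset_sum\<close>) shows that the sum of \<open>(-1) ^ card K\<close> over all sets \<open>K\<close> of terms with
  abelian product one vanishes modulo three. Let the sequence be product-one-free. A nonempty
  set \<open>K\<close> of this kind contains two terms that do not commute, and not all three values are
  attained. By \<open>bad_or_full\<close> it is then \<^emph>\<open>bad\<close>: it has three terms with \<open>\<omega> = 1\<close> around a
  triangle, and all its other terms commute with every term of \<open>K\<close>. So the sum of the signs of
  the bad sets of abelian product one is \<open>-1\<close>. The same argument modulo the subgroup \<open>range cp\<close>,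
  with two noncommuting terms removed, shows that the signs of those bad sets that contain two
  given noncommuting terms sum up to zero. In this reduction the two values \<open>1\<close> and \<open>-1\<close> are
  attained by every bad set (\<open>bad_attained\<close>), so that an abelian product in \<open>range cp\<close> must be
  one.

  \<^bold>\<open>Weights of triangles.\<close> Collecting the bad sets by the triangle in \<open>V\<close> that they contain gives
  weights of triangles. The weights of all triangles on a fixed edge sum up to \<open>0\<close>, and all
  weights together sum up to \<open>-1\<close>. A triangle of nonzero weight is called active. If \<open>s\<close> is the
  sum of its vertices and \<open>s \<noteq> 0\<close>, then the remaining terms of a bad set are multiples of \<open>s\<close>
  with sum \<open>-s\<close>, so \<open>-s\<close> occurs among the terms or \<open>s\<close> occurs twice.

  \<^bold>\<open>Two lines on an edge are impossible.\<close> Only \<open>12\<close> terms lie outside the center. Every active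
  triangle has on each of its edges another active triangle, which requires more and more
  vectors among these terms. An exhaustive search shows that two active triangles with a common
  edge, or with edges in a common triangle of sum zero, have orthogonal vertex sums; otherwise
  more than \<open>12\<close> terms would be needed (\<open>no_two_lines\<close>).

  \<^bold>\<open>Conclusion.\<close> By orthogonality, the sums of the active triangles at an active triangle lie on
  one line (or are zero), and two active triangles with a common edge define the same three
  cosets of the same line. For a fixed triple of cosets, the triangles are grouped by their
  vertices in two of the cosets; each group consists of all active triangles on one edge and has
  total weight zero. Hence the weights sum up to \<open>0\<close>, not to \<open>-1\<close>.
\<close>

section \<open>A symplectic space of dimension four over the field with three elements\<close>

text \<open>
  The field with three elements, as a datatype, so that the arithmetic of the search below can
  be evaluated by rewriting.
\<close>

datatype f3 = F0 | F1 | F2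

instantiation f3 :: comm_ring_1
begin

definition zero_f3 :: f3 where [code]: "0 = F0"
definition one_f3 :: f3 where [code]: "1 = F1"

fun plus_f3 :: "f3 \<Rightarrow> f3 \<Rightarrow> f3" where
  "F0 + y = y"
| "F1 + F0 = F1" | "F1 + F1 = F2" | "F1 + F2 = F0"
| "F2 + F0 = F2" | "F2 + F1 = F0" | "F2 + F2 = F1"

fun uminus_f3 :: "f3 \<Rightarrow> f3" where
  "- F0 = F0" | "- F1 = F2" | "- F2 = F1"

definition minus_f3 :: "f3 \<Rightarrow> f3 \<Rightarrow> f3" where "x - y = x + (- y :: f3)"

fun times_f3 :: "f3 \<Rightarrow> f3 \<Rightarrow> f3" where
  "F0 * y = F0" | "F1 * y = y" | "F2 * y = - y"

instance
proof
  fix x y z :: f3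
  show "x + y + z = x + (y + z)" by (cases x; cases y; cases z) simp_all
  show "x + y = y + x" by (cases x; cases y) simp_all
  show "0 + x = x" by (simp add: zero_f3_def)
  show "- x + x = 0" by (cases x) (simp_all add: zero_f3_def)
  show "x - y = x + - y" by (simp add: minus_f3_def)
  show "x * y * z = x * (y * z)" by (cases x; cases y; cases z) simp_all
  show "x * y = y * x" by (cases x; cases y) simp_all
  show "1 * x = x" by (simp add: one_f3_def)
  show "(x + y) * z = x * z + y * z" by (cases x; cases y; cases z) simp_all
  show "(0::f3) \<noteq> 1" by (simp add: zero_f3_def one_f3_def)
qed

end

lemma f3_triple [simp]: "x + x + x = (0::f3)" "x + (x + x) = (0::f3)"
  by (cases x; simp add: zero_f3_def)+

lemma f3_three [simp]: "(3::f3) = 0"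
proof -
  have "(3::f3) = 1 + 1 + 1" by simp
  also have "\<dots> = 0" by (simp only: one_f3_def zero_f3_def plus_f3.simps)
  finally show ?thesis .
qed

lemma f3_double: "x + x = - (x::f3)"
  by (cases x) simp_all

lemma f3_neg_eq_self: "- x = x \<longleftrightarrow> x = (0::f3)"
  by (cases x) (simp_all add: zero_f3_def)

text \<open>Coordinate vectors of length four.\<close>

datatype vec = Vec f3 f3 f3 f3

instantiation vec :: ab_group_add
begin

definition zero_vec :: vec where "0 = Vec F0 F0 F0 F0"

fun plus_vec :: "vec \<Rightarrow> vec \<Rightarrow> vec" where
  "Vec a b c d + Vec a' b' c' d' = Vec (a + a') (b + b') (c + c') (d + d')"

fun uminus_vec :: "vec \<Rightarrow> vec" where
  "- Vec a b c d = Vec (- a) (- b) (- c) (- d)"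

definition minus_vec :: "vec \<Rightarrow> vec \<Rightarrow> vec" where "x - y = x + (- y :: vec)"

instance
proof
  fix x y z :: vec
  show "x + y + z = x + (y + z)" by (cases x; cases y; cases z) (simp add: add.assoc)
  show "x + y = y + x" by (cases x; cases y) (simp add: add.commute)
  show "0 + x = x" by (cases x) (simp add: zero_vec_def)
  show "- x + x = 0" by (cases x) (simp add: zero_vec_def zero_f3_def[symmetric])
  show "x - y = x + - y" by (simp add: minus_vec_def)
qed

end

fun scale :: "f3 \<Rightarrow> vec \<Rightarrow> vec" where
  "scale t (Vec a b c d) = Vec (t * a) (t * b) (t * c) (t * d)"

text \<open>
  The standard symplectic form, in which the first two and the last two coordinates form
  hyperbolic pairs.
\<close>

fun omega :: "vec \<Rightarrow> vec \<Rightarrow> f3" where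
  "omega (Vec a b c d) (Vec a' b' c' d') = (a * b' + - (b * a')) + (c * d' + - (d * c'))"

lemma omega_add_left: "omega (x + y) z = omega x z + omega y z"
  by (cases x; cases y; cases z) (simp add: algebra_simps)

lemma omega_add_right: "omega x (y + z) = omega x y + omega x z"
  by (cases x; cases y; cases z) (simp add: algebra_simps)

lemma omega_minus_left: "omega (- x) y = - omega x y"
  by (cases x; cases y) (simp add: algebra_simps)

lemma omega_minus_right: "omega x (- y) = - omega x y"
  by (cases x; cases y) (simp add: algebra_simps)

lemma omega_scale_left: "omega (scale t x) y = t * omega x y"
  by (cases x; cases y) (simp add: algebra_simps)

lemma omega_scale_right: "omega x (scale t y) = t * omega x y"
  by (cases x; cases y) (simp add: algebra_simps)

lemma omega_self [simp]: "omega x x = 0"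
  by (cases x) (simp add: algebra_simps)

lemma omega_zero [simp]: "omega 0 x = 0" "omega x 0 = 0"
  by (cases x; simp add: zero_vec_def zero_f3_def[symmetric])+

lemma omega_swap: "omega y x = - omega x y"
  by (cases x; cases y) (simp add: algebra_simps)

lemmas omega_bilinear = omega_add_left omega_add_right omega_minus_left omega_minus_right
  omega_scale_left omega_scale_right

lemma omega_diff_left: "omega (x - y) z = omega x z - omega y z"
  by (simp only: diff_conv_add_uminus omega_add_left omega_minus_left)

lemma omega_diff_right: "omega x (y - z) = omega x y - omega x z"
  by (simp only: diff_conv_add_uminus omega_add_right omega_minus_right)

lemma omega_nondegenerate:
  assumes "\<And>y. omega x y = 0"
  shows "x = 0"
proof -
  obtain a b c d where x: "x = Vec a b c d" by (cases x)
  have "omega x (Vec 1 0 0 0) = 0" "omega x (Vec 0 1 0 0) = 0" "omega x (Vec 0 0 1 0) = 0" "omega x (Vec 0 0 0 1) = 0"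
    using assms by blast+
  then show ?thesis unfolding x by (simp add: zero_vec_def zero_f3_def[symmetric])
qed

lemma vec_double: "x + x = - (x::vec)"
  by (cases x) (simp add: f3_double)

lemma vec_neg_eq_self: "- x = x \<longleftrightarrow> x = (0::vec)"
  by (cases x) (simp add: f3_neg_eq_self zero_vec_def zero_f3_def)

instance f3 :: finite
proof
  have "(UNIV :: f3 set) \<subseteq> {F0, F1, F2}" using f3.exhaust by auto
  then show "finite (UNIV :: f3 set)" using finite_subset by blast
qed

lemma card_f3: "card (UNIV :: f3 set) = 3"
proof -
  have "(UNIV :: f3 set) = {F0, F1, F2}" using f3.exhaust by auto
  moreover have "card {F0, F1, F2} = 3" by simp
  ultimately show ?thesis by (simp only:)
qed

instance vec :: finite
proof
  have "x \<in> (\<lambda>(a, b, c, d). Vec a b c d) ` UNIV" for x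
    by (cases x) (auto simp: image_iff)
  then have "(UNIV :: vec set) \<subseteq> (\<lambda>(a, b, c, d). Vec a b c d) ` UNIV" by blast
  then show "finite (UNIV :: vec set)" by (rule finite_subset) simp
qed

text \<open>The linear map that takes the standard basis to \<open>a\<close>, \<open>b\<close>, \<open>v\<close>, \<open>w\<close>.\<close>

fun frame :: "vec \<Rightarrow> vec \<Rightarrow> vec \<Rightarrow> vec \<Rightarrow> vec \<Rightarrow> vec" where
  "frame a b v w (Vec p q r t) = scale p a + scale q b + scale r v + scale t w"

lemma scale_add: "scale (p + q) x = scale p x + scale q x"
  by (cases x) (simp add: algebra_simps)

lemma scale_neg: "scale (- p) x = - scale p x"
  by (cases x) (simp add: algebra_simps)

lemma scale_simps [simp]: "scale F0 x = 0" "scale F1 x = x" "scale F2 x = - x" "scale 0 x = 0" "scale 1 x = x"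
  by (cases x; simp add: zero_vec_def zero_f3_def one_f3_def)+

lemma frame_add: "frame a b v w (x + y) = frame a b v w x + frame a b v w y"
  by (cases x; cases y) (simp add: scale_add algebra_simps)

lemma frame_uminus: "frame a b v w (- x) = - frame a b v w x"
  by (cases x) (simp add: scale_neg algebra_simps)

lemma frame_isometry:
  assumes "omega a b = 1" "omega v w = 1"
    and "omega a v = 0" "omega a w = 0" "omega b v = 0" "omega b w = 0"
  shows "omega (frame a b v w x) (frame a b v w y) = omega x y"
proof -
  have "omega b a = - 1" "omega w v = - 1" "omega v a = 0" "omega w a = 0" "omega v b = 0" "omega w b = 0"
    using assms omega_swap by (metis minus_zero)+
  then show ?thesis using assms
    by (cases x; cases y) (simp add: omega_bilinear algebra_simps)
qed

lemma frame_bij: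
  assumes "omega a b = 1" "omega v w = 1"
    and "omega a v = 0" "omega a w = 0" "omega b v = 0" "omega b w = 0"
  shows "bij (frame a b v w)"
proof -
  have "inj (frame a b v w)"
  proof (rule injI)
    fix x y assume e: "frame a b v w x = frame a b v w y"
    have "omega (x + - y) z = 0" for z
    proof -
      have "omega (x + - y) z = omega (frame a b v w (x + - y)) (frame a b v w z)"
        using frame_isometry[OF assms] by simp
      also have "\<dots> = 0" using e by (simp only: frame_add frame_uminus add.right_inverse omega_zero)
      finally show ?thesis .
    qed
    then have "x + - y = 0" by (rule omega_nondegenerate)
    then show "x = y" by (simp add: eq_neg_iff_add_eq_0)
  qed
  then show ?thesis by (simp add: finite_UNIV_inj_surj bij_def)
qed

lemma f3_square: "x \<noteq> 0 \<Longrightarrow> x * x = (1::f3)"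
  by (cases x) (simp_all add: zero_f3_def one_f3_def)

lemma orthogonal_to_frame:
  assumes ab: "omega a b = 1" and vw: "omega v w \<noteq> 0"
    and o: "omega a v = 0" "omega a w = 0" "omega b v = 0" "omega b w = 0"
    and y: "omega a y = 0" "omega b y = 0" "omega v y = 0" "omega w y = 0"
  shows "y = 0"
proof -
  define w' where "w' = scale (omega v w) w"
  have vw': "omega v w' = 1" "omega a w' = 0" "omega b w' = 0" "omega w' y = 0"
    using vw o y by (simp_all add: w'_def omega_scale_right omega_scale_left f3_square)
  note bij = frame_bij[OF ab vw'(1) o(1) vw'(2) o(3) vw'(3)]
  have "omega y z = 0" for z
  proof -
    obtain p where z: "z = frame a b v w' p" using bij by (metis bij_pointE)
    have "omega z y = 0" unfolding z using y vw' by (cases p) (simp add: omega_bilinear)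
    then show ?thesis using omega_swap[of y z] by simp
  qed
  then show ?thesis by (rule omega_nondegenerate)
qed

text \<open>In the plane orthogonal to a hyperbolic pair, orthogonal vectors are proportional.\<close>

lemma orthogonal_plane:
  assumes ab: "omega a b = 1" and x: "omega a x = 0" "omega b x = 0" "x \<noteq> 0"
    and y: "omega a y = 0" "omega b y = 0" and xy: "omega x y = 0"
  shows "y = 0 \<or> y = x \<or> y = - x"
proof -
  have "\<exists>w. omega a w = 0 \<and> omega b w = 0 \<and> omega x w \<noteq> 0"
  proof (rule ccontr)
    assume n: "\<not> ?thesis"
    have "omega x z = 0" for z
    proof -
      let ?w = "z + scale (omega b z) a + scale (- omega a z) b"
      have "omega b a = - 1" using ab omega_swap by metis
      then have "omega a ?w = 0" "omega b ?w = 0" using ab by (simp_all add: omega_bilinear)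
      then have "omega x ?w = 0" using n by blast
      moreover have "omega x a = 0" "omega x b = 0" using x omega_swap by (metis minus_zero)+
      ultimately show ?thesis by (simp add: omega_bilinear)
    qed
    then show False using omega_nondegenerate x(3) by blast
  qed
  then obtain w where w: "omega a w = 0" "omega b w = 0" "omega x w \<noteq> 0" by blast
  define t where "t = omega x w * omega y w"
  let ?y = "y + scale (- t) x"
  have "?y = 0"
  proof (rule orthogonal_to_frame[OF ab w(3) x(1) w(1) x(2) w(2)])
    show "omega a ?y = 0" "omega b ?y = 0" "omega x ?y = 0"
      using x y xy by (simp_all add: omega_bilinear)
    have "omega w ?y = - omega y w + t * omega x w"
      using omega_swap[of w x] omega_swap[of w y] by (simp add: omega_bilinear)
    also have "\<dots> = - omega y w + (omega x w * omega x w) * omega y w" by (simp add: t_def mult_ac)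
    also have "\<dots> = 0" using f3_square[OF w(3)] by simp
    finally show "omega w ?y = 0" .
  qed
  then have "y = scale t x" by (simp add: scale_neg eq_neg_iff_add_eq_0)
  then show ?thesis by (cases t) simp_all
qed

section \<open>Search for a system of triangles\<close>

text \<open>
  The search tries to extend a system of triangles \<open>(a, b, k)\<close> with
  \<open>\<omega>(a, b) = \<omega>(b, k) = \<omega>(k, a) = 1\<close> that is closed under the following rule: an edge \<open>(a, b)\<close> of
  a triangle lies in at least two triangles. The third vertices \<open>k\<close> on the edge \<open>(a, b)\<close> are the
  vectors \<open>-(a + b) + s\<close> with \<open>s\<close> orthogonal to \<open>a\<close> and \<open>b\<close>, so there are nine of them. Each
  triangle needs the vector \<open>k\<close>, and also \<open>-s\<close> if \<open>s \<noteq> 0\<close>; at most \<open>12\<close> different vectors can be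
  provided.

  The functions use \<open>if\<close> with decidable equality tests and unary numbers only, which keeps
  evaluation by rewriting fast.
\<close>

fun eq_f3 :: "f3 \<Rightarrow> f3 \<Rightarrow> bool" where
  "eq_f3 F0 F0 = True" | "eq_f3 F1 F1 = True" | "eq_f3 F2 F2 = True" | "eq_f3 _ _ = False"

fun eq_vec :: "vec \<Rightarrow> vec \<Rightarrow> bool" where
  "eq_vec (Vec a b c d) (Vec a' b' c' d') =
    (if eq_f3 a a' then if eq_f3 b b' then if eq_f3 c c' then eq_f3 d d' else False else False else False)"

lemma eq_f3_iff [simp]: "eq_f3 x y \<longleftrightarrow> x = y"
  by (cases x; cases y) simp_all

lemma eq_vec_iff [simp]: "eq_vec x y \<longleftrightarrow> x = y"
  by (cases x; cases y) simp

fun vmem :: "vec \<Rightarrow> vec list \<Rightarrow> bool" where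
  "vmem x [] = False" | "vmem x (y # ys) = (if eq_vec x y then True else vmem x ys)"

fun emem :: "vec \<Rightarrow> vec \<Rightarrow> (vec \<times> vec) list \<Rightarrow> bool" where
  "emem a b [] = False"
| "emem a b ((x, y) # es) = (if eq_vec a x then if eq_vec b y then True else emem a b es else emem a b es)"

text \<open>
  An obligation \<open>(a, b, k)\<close> records a triangle whose edge \<open>(a, b)\<close> still has to be given a third
  vertex other than \<open>k\<close>.
\<close>

type_synonym obligation = "vec \<times> vec \<times> vec"

text \<open>Whether the edge \<open>(a, b)\<close> has an obligation in a list, and the removal of the first one.\<close>

fun omem :: "vec \<Rightarrow> vec \<Rightarrow> obligation list \<Rightarrow> bool" where
  "omem a b [] = False"
| "omem a b ((x, y, k) # os) =
    (if eq_vec a x then if eq_vec b y then True else omem a b os else omem a b os)"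

fun odel :: "vec \<Rightarrow> vec \<Rightarrow> obligation list \<Rightarrow> obligation list" where
  "odel a b [] = []"
| "odel a b ((x, y, k) # os) =
    (if eq_vec a x then if eq_vec b y then os else (x, y, k) # odel a b os else (x, y, k) # odel a b os)"

text \<open>
  Registration of the edge \<open>(x, y)\<close> of a new triangle with third vertex \<open>w\<close>. Nothing is done for
  an edge in the list \<open>es\<close> of settled edges. An edge that already has an obligation becomes
  settled, as the new triangle is meant to meet it; otherwise a new obligation is queued. The
  soundness of the search does not depend on this bookkeeping, since dropping an obligation is
  always permitted.
\<close>

fun demand :: "vec \<Rightarrow> vec \<Rightarrow> vec \<Rightarrow> (vec \<times> vec) list \<Rightarrow> obligation list \<Rightarrow>
    (vec \<times> vec) list \<times> obligation list" where
  "demand x y w es os = (if emem x y es then (es, os)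
     else if omem x y os then ((x, y) # es, odel x y os) else (es, os @ [(x, y, w)]))"

text \<open>
  Adds the vector \<open>k\<close> to the list \<open>M\<close> of provided vectors if it is new; \<open>n\<close> counts how many
  further vectors are permitted.
\<close>

fun require :: "nat \<Rightarrow> vec list \<Rightarrow> vec \<Rightarrow> (nat \<times> vec list) option" where
  "require n M k =
    (if vmem k M then Some (n, M) else (case n of 0 \<Rightarrow> None | Suc n' \<Rightarrow> Some (n', k # M)))"

text \<open>
  A state consists of the number of vectors that may still be added, the vectors provided so
  far, the settled edges and the queue of obligations.
\<close>

type_synonym state = "nat \<times> vec list \<times> (vec \<times> vec) list \<times> obligation list"

text \<open>The state after adding the triangle \<open>(a, b, k)\<close>, whose other two edges are registered.\<close>

fun child :: "nat \<Rightarrow> vec list \<Rightarrow> (vec \<times> vec) list \<Rightarrow> obligation list \<Rightarrow> vec \<Rightarrow> vec \<Rightarrow> vec \<Rightarrow> state" where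
  "child n M es os a b k =
    (case demand b k a es os of (es', os') \<Rightarrow>
      (case demand k a b es' os' of (es'', os'') \<Rightarrow> (n, M, es'', os'')))"

text \<open>
  The states reached by adding to the edge \<open>(a, b)\<close> a third vertex \<open>c + s\<close> other than \<open>k0\<close>, for
  \<open>s\<close> in a given list; here \<open>c\<close> stands for \<open>-(a + b)\<close>. Choices that exceed the bound on the
  number of vectors are dropped.
\<close>

fun children :: "nat \<Rightarrow> vec list \<Rightarrow> (vec \<times> vec) list \<Rightarrow> obligation list \<Rightarrow>
    vec \<Rightarrow> vec \<Rightarrow> vec \<Rightarrow> vec \<Rightarrow> vec list \<Rightarrow> state list" where
  "children n M es os a b k0 c [] = []"
| "children n M es os a b k0 c (s # ss) =
    (let k = c + s in
      if eq_vec k k0 then children n M es os a b k0 c ss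
      else (case require n M k of None \<Rightarrow> children n M es os a b k0 c ss
        | Some (n1, M1) \<Rightarrow>
          if eq_vec s 0 then child n1 M1 es os a b k # children n M es os a b k0 c ss
          else (case require n1 M1 (- s) of None \<Rightarrow> children n M es os a b k0 c ss
            | Some (n2, M2) \<Rightarrow> child n2 M2 es os a b k # children n M es os a b k0 c ss)))"

text \<open>The projection to the orthogonal complement of \<open>a\<close> and \<open>b\<close>, provided that \<open>\<omega>(a, b) = 1\<close>.\<close>

fun proj :: "vec \<Rightarrow> vec \<Rightarrow> vec \<Rightarrow> vec" where
  "proj a b w = w + (scale (omega b w) a + scale (omega w a) b)"

text \<open>
  A basis of the plane orthogonal to \<open>a\<close> and \<open>b\<close>, obtained by projecting pairs from a list of
  candidates.
\<close>

fun perp_basis :: "vec \<Rightarrow> vec \<Rightarrow> (vec \<times> vec) list \<Rightarrow> (vec \<times> vec) option" where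
  "perp_basis a b [] = None"
| "perp_basis a b ((v, w) # r) =
    (let v' = proj a b v; w' = proj a b w in
      if eq_f3 (omega v' w') F0 then perp_basis a b r else Some (v', w'))"

text \<open>The pairs of standard basis vectors, as candidates for the projection.\<close>

definition coord_pairs :: "(vec \<times> vec) list" where
  "coord_pairs =
    (let e1 = Vec F1 F0 F0 F0; e2 = Vec F0 F1 F0 F0; e3 = Vec F0 F0 F1 F0; e4 = Vec F0 F0 F0 F1
     in [(e3, e4), (e1, e2), (e1, e3), (e1, e4), (e2, e3), (e2, e4)])"

text \<open>All linear combinations of \<open>v\<close> and \<open>w\<close>.\<close>

fun plane :: "vec \<Rightarrow> vec \<Rightarrow> vec list" where
  "plane v w = (let v2 = - v; w2 = - w in
    [0, v, v2, w, w2, v + w, v + w2, v2 + w, v2 + w2])"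

text \<open>
  The state has no completion: expanding the first obligation in all possible ways leads, within
  depth \<open>d\<close>, to exceeding the bound on the number of vectors in every branch.
\<close>

fun refuted :: "nat \<Rightarrow> state \<Rightarrow> bool" where
  "refuted 0 st = False"
| "refuted (Suc d) (n, M, es, []) = False"
| "refuted (Suc d) (n, M, es, (a, b, k0) # os) =
    (case perp_basis a b coord_pairs of None \<Rightarrow> False
     | Some (v, w) \<Rightarrow> list_all (refuted d) (children n M ((a, b) # es) os a b k0 (- (a + b)) (plane v w)))"

lemma vmem_iff [simp]: "vmem x xs \<longleftrightarrow> x \<in> set xs"
  by (induction xs) auto

lemma proj_orthogonal:
  assumes "omega a b = 1"
  shows "omega a (proj a b w) = 0" "omega b (proj a b w) = 0"
proof -
  have "omega b a = - 1" "omega w a = - omega a w" using assms omega_swap by metis+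
  then show "omega a (proj a b w) = 0" "omega b (proj a b w) = 0"
    using assms by (simp_all add: omega_bilinear)
qed

lemma perp_basisD:
  assumes "perp_basis a b L = Some (v, w)" "omega a b = 1"
  shows "omega a v = 0" "omega b v = 0" "omega a w = 0" "omega b w = 0" "omega v w \<noteq> 0"
proof -
  have "\<exists>v0 w0. v = proj a b v0 \<and> w = proj a b w0 \<and> omega v w \<noteq> 0"
    using assms(1)
    by (induction a b L rule: perp_basis.induct)
       (auto simp: Let_def zero_f3_def simp del: proj.simps split: if_splits)
  then obtain v0 w0 where e: "v = proj a b v0" "w = proj a b w0" "omega v w \<noteq> 0" by blast
  show "omega a v = 0" "omega b v = 0" "omega a w = 0" "omega b w = 0" "omega v w \<noteq> 0"
    using e proj_orthogonal[OF assms(2)] by auto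
qed

lemma plane_complete:
  assumes pb: "perp_basis a b L = Some (v, w)" and ab: "omega a b = 1"
    and s: "omega a s = 0" "omega b s = 0"
  shows "s \<in> set (plane v w)"
proof -
  note p = perp_basisD[OF pb ab]
  define r where "r = omega v w"
  define p' q' where "p' = r * omega s w" and "q' = r * omega v s"
  have rr: "r * r = 1" using p(5) f3_square r_def by simp
  let ?y = "s + scale (- p') v + scale (- q') w"
  have "?y = 0"
  proof (rule orthogonal_to_frame[OF ab p(5) p(1) p(3) p(2) p(4)])
    show "omega a ?y = 0" "omega b ?y = 0" using p s by (simp_all add: omega_bilinear)
    have "omega v ?y = omega v s + - ((r * r) * omega v s)"
      by (simp add: omega_bilinear q'_def r_def[symmetric] mult_ac)
    then show "omega v ?y = 0" by (simp add: rr)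
    have "omega w ?y = - omega s w + (r * r) * omega s w"
      using omega_swap[of w v] omega_swap[of w s]
      by (simp add: omega_bilinear p'_def r_def[symmetric] mult_ac)
    then show "omega w ?y = 0" by (simp add: rr)
  qed
  then have "s = scale p' v + scale q' w"
    by (simp add: scale_neg algebra_simps)
  then show ?thesis by (cases p'; cases q') (simp_all add: Let_def)
qed

section \<open>Soundness of the search\<close>

text \<open>
  The combinatorial properties of the triangles of nonzero weight that the search uses. The
  vectors \<open>u i\<close> are the images in \<open>V\<close> of the noncentral terms, indexed by \<open>J\<close>.
\<close>

locale active_complex =
  fixes act :: "vec \<Rightarrow> vec \<Rightarrow> vec \<Rightarrow> bool"
    and J :: "'i set" and u :: "'i \<Rightarrow> vec"
  assumes fin: "finite J" and card_J: "card J \<le> 12"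
    and u_nonzero: "\<And>i. i \<in> J \<Longrightarrow> u i \<noteq> 0"
    and act_rotate: "\<And>a b k. act a b k \<Longrightarrow> act b k a"
    and act_omega: "\<And>a b k. act a b k \<Longrightarrow> omega a b = 1"
    and act_mem: "\<And>a b k. act a b k \<Longrightarrow> a \<in> u ` J"
    and act_other: "\<And>a b k. act a b k \<Longrightarrow> \<exists>k'. act a b k' \<and> k' \<noteq> k"
    and act_sum: "\<And>a b k. act a b k \<Longrightarrow> a + b + k \<noteq> 0 \<Longrightarrow>
      - (a + b + k) \<in> u ` J \<or> card {i \<in> J. u i = a + b + k} \<ge> 2"
begin

text \<open>
  Occurrence of \<open>x\<close>, or two occurrences of \<open>- x\<close>. The nonzero multiples \<open>x\<close> and \<open>- x\<close> of a
  vector together use up at least as many indices as there are available vectors among them, so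
  at most \<open>12\<close> vectors are available.
\<close>

definition available :: "vec \<Rightarrow> bool" where
  "available x \<longleftrightarrow> x \<noteq> 0 \<and> (x \<in> u ` J \<or> card {i \<in> J. u i = - x} \<ge> 2)"

lemma card_available:
  assumes "\<And>x. x \<in> Q \<Longrightarrow> available x"
  shows "card Q \<le> 12"
proof -
  \<comment> \<open>Vectors and indices are counted separately for each pair of opposite vectors.\<close>
  define A where "A x = {x, - x}" for x :: vec
  have A_eq: "A y = A x" if "y \<in> A x" for x y using that by (auto simp: A_def)
  have fQ: "finite Q" by simp
  have line: "card {x \<in> Q. A x = L} \<le> card {i \<in> J. A (u i) = L}" if "L \<in> A ` Q" for L
  proof -
    obtain x where x: "x \<in> Q" "L = A x" using \<open>L \<in> A ` Q\<close> by blast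
    have x0: "x \<noteq> 0" using x assms available_def by blast
    then have xm: "- x \<noteq> x" by (simp add: vec_neg_eq_self)
    have sub: "{i \<in> J. u i = y} \<subseteq> {i \<in> J. A (u i) = L}" if "y \<in> L" for y
      using that A_eq x(2) by auto
    have fI: "finite {i \<in> J. A (u i) = L}" using fin by simp
    have two: "card {i \<in> J. A (u i) = L} \<ge> 2"
      if "card {i \<in> J. u i = y} \<ge> 2" "y \<in> L" for y
      using card_mono[OF fI sub[OF that(2)]] that(1) by linarith
    have "{x' \<in> Q. A x' = L} \<subseteq> {x, - x}" using x by (auto simp: A_def doubleton_eq_iff)
    show ?thesis
    proof (cases "- x \<in> Q")
      case True
      have "card {x' \<in> Q. A x' = L} \<le> 2"
        using card_mono[OF _ \<open>{x' \<in> Q. A x' = L} \<subseteq> {x, - x}\<close>] xm by (simp add: card_insert_if)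
      moreover have "card {i \<in> J. A (u i) = L} \<ge> 2"
      proof -
        have ax: "x \<in> u ` J \<or> card {i \<in> J. u i = - x} \<ge> 2"
          and amx: "- x \<in> u ` J \<or> card {i \<in> J. u i = x} \<ge> 2"
          using assms[OF x(1)] assms[OF True] by (auto simp: available_def)
        show ?thesis
        proof (cases "x \<in> u ` J \<and> - x \<in> u ` J")
          case True
          then obtain i j where ij: "i \<in> J" "u i = x" "j \<in> J" "u j = - x" by (metis imageE)
          then have "i \<noteq> j" using xm by auto
          have "{i, j} \<subseteq> {i \<in> J. A (u i) = L}" using ij x(2) by (auto simp: A_def)
          from card_mono[OF fI this] \<open>i \<noteq> j\<close> show ?thesis by simp
        next
          case False
          then show ?thesis using ax amx two[of x] two[of "- x"] x(2) by (auto simp: A_def)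
        qed
      qed
      ultimately show ?thesis by linarith
    next
      case False
      then have "{x' \<in> Q. A x' = L} \<subseteq> {x}" using \<open>{x' \<in> Q. A x' = L} \<subseteq> {x, - x}\<close> by blast
      then have c1: "card {x' \<in> Q. A x' = L} \<le> 1" using card_mono[of "{x}"] by fastforce
      have "\<exists>i \<in> J. A (u i) = L"
      proof (cases "x \<in> u ` J")
        case True then show ?thesis using x(2) by auto
      next
        case False
        then have "card {i \<in> J. u i = - x} \<ge> 2" using assms[OF x(1)] by (auto simp: available_def)
        then obtain i where "i \<in> J" "u i = - x" by (metis (mono_tags, lifting) card.empty empty_Collect_eq not_numeral_le_zero)
        then show ?thesis using x(2) by (auto simp: A_def insert_commute)
      qed
      then have "{i \<in> J. A (u i) = L} \<noteq> {}" by blast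
      then have "card {i \<in> J. A (u i) = L} \<ge> 1" using fI by (simp add: card_gt_0_iff Suc_le_eq)
      then show ?thesis using c1 by linarith
    qed
  qed
  have "card Q = (\<Sum>L\<in>A ` Q. card {x \<in> Q. A x = L})"
    using sum.image_gen[OF fQ, of "\<lambda>_. 1::nat" A] by simp
  also have "\<dots> \<le> (\<Sum>L\<in>A ` Q. card {i \<in> J. A (u i) = L})" by (rule sum_mono[OF line])
  also have "\<dots> = card (\<Union>L\<in>A ` Q. {i \<in> J. A (u i) = L})"
    by (rule card_UN_disjoint[symmetric]) (use fin in auto)
  also have "\<dots> \<le> card J" by (rule card_mono) (use fin in auto)
  finally show ?thesis using card_J by linarith
qed

text \<open>
  The state describes part of the given complex: its vectors are available and its obligations
  come from active triangles. Settled edges carry no information.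
\<close>

fun consistent :: "state \<Rightarrow> bool" where
  "consistent (n, M, es, os) \<longleftrightarrow> distinct M \<and> length M + n = 12 \<and>
    (\<forall>x \<in> set M. available x) \<and> (\<forall>(a, b, k) \<in> set os. act a b k)"

lemma require_available:
  assumes "distinct M" "length M + n = 12" "\<forall>x \<in> set M. available x" "available k"
  shows "\<exists>n' M'. require n M k = Some (n', M') \<and> distinct M' \<and> length M' + n' = 12 \<and>
    (\<forall>x \<in> set M'. available x)"
proof (cases "k \<in> set M")
  case True
  then show ?thesis using assms by auto
next
  case False
  have "card (set (k # M)) \<le> 12" by (rule card_available) (use assms in auto)
  then have "n \<noteq> 0" using assms False by (auto simp: distinct_card)
  then obtain n' where "n = Suc n'" using not0_implies_Suc by blast
  then show ?thesis using assms False by auto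
qed

lemma set_odel: "set (odel a b os) \<subseteq> set os"
  by (induction a b os rule: odel.induct) auto

lemma demand_consistent:
  assumes "act x y w" "\<forall>(a, b, k) \<in> set os. act a b k" "demand x y w es os = (es', os')"
  shows "\<forall>(a, b, k) \<in> set os'. act a b k"
  using assms set_odel[of x y os] by (auto split: if_splits)

lemma child_consistent:
  assumes "act a b k" "consistent (n, M, es, os)"
  shows "consistent (child n M es' os a b k)"
proof -
  obtain e1 o1 where d1: "demand b k a es' os = (e1, o1)" by (cases "demand b k a es' os")
  obtain e2 o2 where d2: "demand k a b e1 o1 = (e2, o2)" by (cases "demand k a b e1 o1")
  have "\<forall>(a, b, k) \<in> set o1. act a b k"
    using demand_consistent[OF act_rotate[OF assms(1)] _ d1] assms(2) by simp
  then have "\<forall>(a, b, k) \<in> set o2. act a b k"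
    using demand_consistent[OF act_rotate[OF act_rotate[OF assms(1)]] _ d2] by simp
  moreover have "child n M es' os a b k = (n, M, e2, o2)"
    using d1 d2 by (simp del: demand.simps)
  ultimately show ?thesis using assms(2) by simp
qed

lemma act_available:
  assumes "act a b k"
  shows "available k"
proof -
  have "act k a b" using act_rotate assms by blast
  then have "k \<in> u ` J" by (rule act_mem)
  moreover from this have "k \<noteq> 0" using u_nonzero by auto
  ultimately show ?thesis by (simp add: available_def)
qed

lemma children_consistent:
  assumes "act a b k" "k \<noteq> k0" "consistent (n, M, es0, os)"
    and "s \<in> set ss" "k = c + s" "a + b + k = s"
  shows "\<exists>st \<in> set (children n M es os a b k0 c ss). consistent st"
  using assms(4)
proof (induction ss)
  case (Cons s' ss)
  have mono: "set (children n M es os a b k0 c ss) \<subseteq> set (children n M es os a b k0 c (s' # ss))"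
    by (auto simp: Let_def simp del: require.simps child.simps split: option.splits)
  show ?case
  proof (cases "s' = s")
    case False
    then show ?thesis using Cons mono by auto
  next
    case True
    have c: "distinct M" "length M + n = 12" "\<forall>x \<in> set M. available x"
      "\<forall>(a, b, k) \<in> set os. act a b k" using assms(3) by auto
    obtain n1 M1 where r1: "require n M k = Some (n1, M1)" "distinct M1" "length M1 + n1 = 12"
      "\<forall>x \<in> set M1. available x"
      using require_available[OF c(1-3) act_available[OF assms(1)]] by blast
    show ?thesis
    proof (cases "s = 0")
      case z: True
      have "child n1 M1 es os a b k \<in> set (children n M es os a b k0 c (s' # ss))"
        using r1 True z assms(2,5) by (simp add: Let_def del: require.simps child.simps)
      moreover have "consistent (child n1 M1 es os a b k)"
        by (rule child_consistent[OF assms(1), of _ _ es]) (use r1 c in simp)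
      ultimately show ?thesis by blast
    next
      case z: False
      have "available (- s)" using act_sum[OF assms(1)] assms(6) z by (auto simp: available_def)
      then obtain n2 M2 where r2: "require n1 M1 (- s) = Some (n2, M2)" "distinct M2"
        "length M2 + n2 = 12" "\<forall>x \<in> set M2. available x"
        using require_available[OF r1(2-4)] by blast
      have "child n2 M2 es os a b k \<in> set (children n M es os a b k0 c (s' # ss))"
        using r1 r2(1) True z assms(2,5) by (simp add: Let_def del: require.simps child.simps)
      moreover have "consistent (child n2 M2 es os a b k)"
        by (rule child_consistent[OF assms(1), of _ _ es]) (use r2 c in simp)
      ultimately show ?thesis by blast
    qed
  qed
qed simp

lemma act_orthogonal:
  assumes "act a b k"
  shows "omega a (a + b + k) = 0" "omega b (a + b + k) = 0"
proof -
  have "omega a b = 1" "omega b k = 1" "omega k a = 1" using assms act_rotate act_omega by blast+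
  then show "omega a (a + b + k) = 0" "omega b (a + b + k) = 0"
    using omega_swap[of a k] omega_swap[of b a] by (simp_all add: omega_bilinear)
qed

text \<open>
  An active triangle that meets the first obligation exists, and it yields a consistent child of
  the state, so a consistent state is never refuted.
\<close>

lemma refuted_sound: "refuted d st \<Longrightarrow> consistent st \<Longrightarrow> False"
proof (induction d arbitrary: st)
  case (Suc d)
  obtain n M es os0 where st: "st = (n, M, es, os0)" by (cases st)
  show ?case
  proof (cases os0)
    case Nil then show ?thesis using Suc.prems st by simp
  next
    case (Cons o1 os)
    obtain a b k0 where o1: "o1 = (a, b, k0)" by (cases o1)
    have act0: "act a b k0" using Suc.prems st Cons o1 by simp
    obtain v w where pb: "perp_basis a b coord_pairs = Some (v, w)"
      and all: "list_all (refuted d) (children n M ((a, b) # es) os a b k0 (- (a + b)) (plane v w))"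
      using Suc.prems(1) st Cons o1 by (auto split: option.splits)
    obtain k where k: "act a b k" "k \<noteq> k0" using act_other[OF act0] by blast
    have "a + b + k \<in> set (plane v w)"
      by (rule plane_complete[OF pb act_omega[OF k(1)] act_orthogonal[OF k(1)]])
    then obtain st' where "st' \<in> set (children n M ((a, b) # es) os a b k0 (- (a + b)) (plane v w))"
      "consistent st'"
      using children_consistent[OF k, of n M es os "a + b + k" "plane v w" "- (a + b)" "(a, b) # es"]
        Suc.prems(2) st Cons by auto
    then show ?thesis using Suc.IH all unfolding list_all_iff by blast
  qed
qed simp

end

section \<open>Active triangles on a common edge\<close>

text \<open>
  The three initial states, in coordinates given by the frame \<open>a\<close>, \<open>b\<close>, \<open>s\<^sub>1\<close>, \<open>s\<^sub>2\<close>. One triangle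
  is \<open>(a, b, s\<^sub>1 - a - b)\<close>. The other one has vertex sum \<open>s\<^sub>2\<close> and lies on the edge \<open>(a, b)\<close>,
  \<open>(b, -a - b)\<close> or \<open>(-a - b, a)\<close>. The list of vectors consists of the vertices, \<open>- s\<^sub>1\<close> and
  \<open>- s\<^sub>2\<close>; in the first state the edge \<open>(a, b)\<close> is settled because both triangles lie on it. The
  bound \<open>30\<close> on the depth is generous.
\<close>

lemma refuted_same_edge:
  "refuted 30 (Suc (Suc (Suc (Suc (Suc (Suc 0))))),
    [Vec F1 F0 F0 F0, Vec F0 F1 F0 F0, Vec F2 F2 F1 F0, Vec F2 F2 F0 F1, Vec F0 F0 F2 F0, Vec F0 F0 F0 F2],
    [(Vec F1 F0 F0 F0, Vec F0 F1 F0 F0)],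
    [(Vec F0 F1 F0 F0, Vec F2 F2 F1 F0, Vec F1 F0 F0 F0),
     (Vec F2 F2 F1 F0, Vec F1 F0 F0 F0, Vec F0 F1 F0 F0),
     (Vec F0 F1 F0 F0, Vec F2 F2 F0 F1, Vec F1 F0 F0 F0),
     (Vec F2 F2 F0 F1, Vec F1 F0 F0 F0, Vec F0 F1 F0 F0)])"
  by code_simp

lemma refuted_next_edge:
  "refuted 30 (Suc (Suc (Suc (Suc (Suc 0)))),
    [Vec F1 F0 F0 F0, Vec F0 F1 F0 F0, Vec F2 F2 F1 F0, Vec F2 F2 F0 F0, Vec F1 F0 F0 F1, Vec F0 F0 F2 F0, Vec F0 F0 F0 F2],
    [],
    [(Vec F1 F0 F0 F0, Vec F0 F1 F0 F0, Vec F2 F2 F1 F0),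
     (Vec F0 F1 F0 F0, Vec F2 F2 F0 F0, Vec F1 F0 F0 F1),
     (Vec F0 F1 F0 F0, Vec F2 F2 F1 F0, Vec F1 F0 F0 F0),
     (Vec F2 F2 F1 F0, Vec F1 F0 F0 F0, Vec F0 F1 F0 F0),
     (Vec F2 F2 F0 F0, Vec F1 F0 F0 F1, Vec F0 F1 F0 F0),
     (Vec F1 F0 F0 F1, Vec F0 F1 F0 F0, Vec F2 F2 F0 F0)])"
  by code_simp

lemma refuted_previous_edge:
  "refuted 30 (Suc (Suc (Suc (Suc (Suc 0)))),
    [Vec F1 F0 F0 F0, Vec F0 F1 F0 F0, Vec F2 F2 F1 F0, Vec F2 F2 F0 F0, Vec F0 F1 F0 F1, Vec F0 F0 F2 F0, Vec F0 F0 F0 F2],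
    [],
    [(Vec F1 F0 F0 F0, Vec F0 F1 F0 F0, Vec F2 F2 F1 F0),
     (Vec F2 F2 F0 F0, Vec F1 F0 F0 F0, Vec F0 F1 F0 F1),
     (Vec F0 F1 F0 F0, Vec F2 F2 F1 F0, Vec F1 F0 F0 F0),
     (Vec F2 F2 F1 F0, Vec F1 F0 F0 F0, Vec F0 F1 F0 F0),
     (Vec F1 F0 F0 F0, Vec F0 F1 F0 F1, Vec F2 F2 F0 F0),
     (Vec F0 F1 F0 F1, Vec F2 F2 F0 F0, Vec F1 F0 F0 F0)])"
  by code_simp

context active_complex
begin

text \<open>The assumptions on a complex are invariant under symplectic changes of coordinates.\<close>

lemma change_frame:
  assumes "omega a b = 1" "omega v w = 1"
    and "omega a v = 0" "omega a w = 0" "omega b v = 0" "omega b w = 0"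
  defines "fr \<equiv> frame a b v w"
  shows "active_complex (\<lambda>p q r. act (fr p) (fr q) (fr r)) J (\<lambda>i. inv_into UNIV fr (u i))"
proof -
  have bij: "bij fr" unfolding fr_def by (rule frame_bij[OF assms(1-6)])
  have inv: "fr (inv_into UNIV fr x) = x" "inv_into UNIV fr (fr x) = x" for x
    using bij by (simp_all add: bij_is_surj surj_f_inv_f bij_is_inj)
  have eq: "inv_into UNIV fr y = x \<longleftrightarrow> y = fr x" for x y using inv by metis
  have eq': "x = inv_into UNIV fr y \<longleftrightarrow> fr x = y" for x y using inv by metis
  have mem: "x \<in> (\<lambda>i. inv_into UNIV fr (u i)) ` J \<longleftrightarrow> fr x \<in> u ` J" for x
    by (simp add: image_iff eq')
  have iso: "omega (fr x) (fr y) = omega x y" for x y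
    unfolding fr_def by (rule frame_isometry[OF assms(1-6)])
  have hom: "fr (x + y) = fr x + fr y" "fr (- x) = - fr x" for x y
    unfolding fr_def by (rule frame_add frame_uminus)+
  have zero: "fr 0 = 0" using hom(1)[of 0 0] by simp
  show ?thesis
  proof
    show "finite J" "card J \<le> 12" by (rule fin card_J)+
    show "inv_into UNIV fr (u i) \<noteq> 0" if "i \<in> J" for i using u_nonzero[OF that] by (simp add: eq zero)
    fix p q r assume act: "act (fr p) (fr q) (fr r)"
    show "act (fr q) (fr r) (fr p)" by (rule act_rotate[OF act])
    show "omega p q = 1" using act_omega[OF act] iso by simp
    show "p \<in> (\<lambda>i. inv_into UNIV fr (u i)) ` J" using act_mem[OF act] mem by simp
    show "\<exists>k'. act (fr p) (fr q) (fr k') \<and> k' \<noteq> r"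
      using act_other[OF act] inv by metis
    assume nz: "p + q + r \<noteq> 0"
    have "fr (p + q + r) \<noteq> 0" using nz inv zero by metis
    then show "- (p + q + r) \<in> (\<lambda>i. inv_into UNIV fr (u i)) ` J \<or>
        2 \<le> card {i \<in> J. inv_into UNIV fr (u i) = p + q + r}"
      using act_sum[OF act] unfolding mem eq hom by blast
  qed
qed

lemma sum_available:
  assumes "act a b k" "a + b + k \<noteq> 0"
  shows "available (- (a + b + k))"
  using act_sum[OF assms] assms(2)
  unfolding available_def minus_minus neg_equal_0_iff_equal by blast

lemma act_orthogonal_third:
  assumes "act a b k"
  shows "omega k (a + b + k) = 0"
  using act_orthogonal(2)[OF act_rotate[OF assms]] by (simp add: ac_simps)

lemma no_two_lines_oriented:
  assumes t1: "act a b k1" and t2: "act x y k2"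
    and xy: "(x, y) = (a, b) \<or> (x, y) = (b, - (a + b)) \<or> (x, y) = (- (a + b), a)"
    and s: "omega (a + b + k1) (x + y + k2) = 1"
  shows False
proof -
  define s1 s2 where "s1 = a + b + k1" and "s2 = x + y + k2"
  have ab: "omega a b = 1" by (rule act_omega[OF t1])
  have o1: "omega a s1 = 0" "omega b s1 = 0" using act_orthogonal[OF t1] by (simp_all add: s1_def)
  have o2': "omega x s2 = 0" "omega y s2 = 0" using act_orthogonal[OF t2] by (simp_all add: s2_def)
  have o2: "omega a s2 = 0 \<and> omega b s2 = 0"
    using xy o2' by (auto simp: omega_bilinear omega_diff_left)
  have ss: "omega s1 s2 = 1" using s by (simp add: s1_def s2_def)
  define fr where "fr = frame a b s1 s2"
  interpret N: active_complex "\<lambda>p q r. act (fr p) (fr q) (fr r)" J "\<lambda>i. inv_into UNIV fr (u i)"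
    unfolding fr_def using change_frame[OF ab ss o1(1) _ o1(2)] o2 by blast
  have fr: "fr (Vec F1 F0 F0 F0) = a" "fr (Vec F0 F1 F0 F0) = b" "fr (Vec F2 F2 F0 F0) = - (a + b)"
    "fr (Vec F2 F2 F1 F0) = k1" "fr (Vec F2 F2 F0 F1) = s2 - (a + b)"
    "fr (Vec F1 F0 F0 F1) = a + s2" "fr (Vec F0 F1 F0 F1) = b + s2"
    by (simp_all add: fr_def s1_def)
  have T1: "act (fr (Vec F1 F0 F0 F0)) (fr (Vec F0 F1 F0 F0)) (fr (Vec F2 F2 F1 F0))"
    using t1 fr by simp
  note R1 = N.act_rotate[OF T1] N.act_rotate[OF N.act_rotate[OF T1]]
  note A1 = N.act_available[OF T1] N.act_available[OF R1(1)] N.act_available[OF R1(2)]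
  have S1: "N.available (Vec F0 F0 F2 F0)"
    using N.sum_available[OF T1] by (simp add: zero_vec_def)
  consider "x = a" "y = b" | "x = b" "y = - (a + b)" | "x = - (a + b)" "y = a" using xy by blast
  then show False
  proof cases
    case 1
    have T2: "act (fr (Vec F1 F0 F0 F0)) (fr (Vec F0 F1 F0 F0)) (fr (Vec F2 F2 F0 F1))"
      using t2 1 unfolding fr by (simp add: s2_def)
    note R2 = N.act_rotate[OF T2] N.act_rotate[OF N.act_rotate[OF T2]]
    note A2 = N.act_available[OF T2] N.act_available[OF R2(1)] N.act_available[OF R2(2)]
    have S2: "N.available (Vec F0 F0 F0 F2)"
      using N.sum_available[OF T2] by (simp add: zero_vec_def)
    show False
      by (rule N.refuted_sound[OF refuted_same_edge]) (use A1 A2 S1 S2 T1 R1 T2 R2 in simp)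
  next
    case 2
    have T2: "act (fr (Vec F0 F1 F0 F0)) (fr (Vec F2 F2 F0 F0)) (fr (Vec F1 F0 F0 F1))"
      using t2 2 unfolding fr by (simp add: s2_def)
    note R2 = N.act_rotate[OF T2] N.act_rotate[OF N.act_rotate[OF T2]]
    note A2 = N.act_available[OF T2] N.act_available[OF R2(1)] N.act_available[OF R2(2)]
    have S2: "N.available (Vec F0 F0 F0 F2)"
      using N.sum_available[OF T2] by (simp add: zero_vec_def)
    show False
      by (rule N.refuted_sound[OF refuted_next_edge]) (use A1 A2 S1 S2 T1 R1 T2 R2 in simp)
  next
    case 3
    have T2: "act (fr (Vec F2 F2 F0 F0)) (fr (Vec F1 F0 F0 F0)) (fr (Vec F0 F1 F0 F1))"
      using t2 3 unfolding fr by (simp add: s2_def)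
    note R2 = N.act_rotate[OF T2] N.act_rotate[OF N.act_rotate[OF T2]]
    note A2 = N.act_available[OF T2] N.act_available[OF R2(1)] N.act_available[OF R2(2)]
    have S2: "N.available (Vec F0 F0 F0 F2)"
      using N.sum_available[OF T2] by (simp add: zero_vec_def)
    show False
      by (rule N.refuted_sound[OF refuted_previous_edge]) (use A1 A2 S1 S2 T1 R1 T2 R2 in simp)
  qed
qed

text \<open>
  In \<open>xy\<close>, the triangle \<open>a\<close>, \<open>b\<close>, \<open>-(a + b)\<close> has sum zero, and \<open>(x, y)\<close> is one of its edges. If
  \<open>\<omega>\<close> of the two sums is \<open>-1\<close>, the triangles are interchanged to get the value \<open>1\<close>.
\<close>

lemma no_two_lines:
  assumes t1: "act a b k1" and t2: "act x y k2"
    and xy: "(x, y) = (a, b) \<or> (x, y) = (b, - (a + b)) \<or> (x, y) = (- (a + b), a)"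
  shows "omega (a + b + k1) (x + y + k2) = 0"
proof (rule ccontr)
  assume n: "\<not> ?thesis"
  show False
  proof (cases "omega (a + b + k1) (x + y + k2) = 1")
    case True
    then show False using no_two_lines_oriented[OF t1 t2 xy] by blast
  next
    case False
    have "omega (x + y + k2) (a + b + k1) = 1"
      using n False omega_swap[of "x + y + k2" "a + b + k1"]
      by (cases "omega (a + b + k1) (x + y + k2)") (simp_all add: zero_f3_def one_f3_def)
    moreover have "(a, b) = (x, y) \<or> (a, b) = (y, - (x + y)) \<or> (a, b) = (- (x + y), x)"
      using xy by auto
    ultimately show False using no_two_lines_oriented[OF t2 t1] by blast
  qed
qed

end

section \<open>Alternating sums over subsets\<close>

text \<open>
  Functions on an abelian group with values in the field with three elements, and the product of
  the difference operators \<open>f \<mapsto> (\<lambda>h. f h - f (h x))\<close> for \<open>x\<close> in a list.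
\<close>

fun iter_diff :: "('a, 'm) monoid_scheme \<Rightarrow> 'a list \<Rightarrow> ('a \<Rightarrow> f3) \<Rightarrow> 'a \<Rightarrow> f3" where
  "iter_diff H [] f = f"
| "iter_diff H (x # xs) f = (\<lambda>h. iter_diff H xs f h - iter_diff H xs f (h \<otimes>\<^bsub>H\<^esub> x))"

definition invariant_under :: "('a, 'm) monoid_scheme \<Rightarrow> 'a set \<Rightarrow> ('a \<Rightarrow> f3) \<Rightarrow> bool" where
  "invariant_under H B f \<longleftrightarrow> (\<forall>h \<in> carrier H. \<forall>b \<in> B. f (h \<otimes>\<^bsub>H\<^esub> b) = f h)"

text \<open>
  Products of at least \<open>n\<close> difference operators with elements from \<open>K\<close> annihilate all functions
  that are invariant under \<open>B\<close>.
\<close>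

definition kills :: "('a, 'm) monoid_scheme \<Rightarrow> 'a set \<Rightarrow> 'a set \<Rightarrow> nat \<Rightarrow> bool" where
  "kills H B K n \<longleftrightarrow> (\<forall>f xs h. invariant_under H B f \<longrightarrow> set xs \<subseteq> K \<longrightarrow> n \<le> length xs \<longrightarrow>
    h \<in> carrier H \<longrightarrow> iter_diff H xs f h = 0)"

context comm_group
begin

lemma iter_diff_cong:
  assumes "set xs \<subseteq> carrier G" "\<And>h. h \<in> carrier G \<Longrightarrow> f h = g h" "h \<in> carrier G"
  shows "iter_diff G xs f h = iter_diff G xs g h"
  using assms(1,3) by (induction xs arbitrary: h) (auto simp: assms(2))

lemma iter_diff_append: "iter_diff G (xs @ ys) f = iter_diff G xs (iter_diff G ys f)"
  by (induction xs) auto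

lemma iter_diff_commute:
  assumes "x \<in> carrier G" "set xs \<subseteq> carrier G" "h \<in> carrier G"
  shows "iter_diff G (x # xs) f h = iter_diff G (xs @ [x]) f h"
  using assms(2,3)
proof (induction xs arbitrary: h)
  case (Cons y ys)
  have "iter_diff G (x # y # ys) f h = iter_diff G (x # ys) f h - iter_diff G (x # ys) f (h \<otimes> y)"
    using Cons.prems assms(1) by (simp add: m_ac algebra_simps)
  also have "\<dots> = iter_diff G (ys @ [x]) f h - iter_diff G (ys @ [x]) f (h \<otimes> y)"
    using Cons.IH Cons.prems by (simp del: iter_diff.simps)
  finally show ?case by simp
qed simp

lemma iter_diff_move:
  assumes "x \<in> carrier G" "set (xs @ ys) \<subseteq> carrier G" "h \<in> carrier G"
  shows "iter_diff G (x # xs @ ys) f h = iter_diff G (xs @ x # ys) f h"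
  using iter_diff_commute[OF assms(1), of xs h "iter_diff G ys f"] assms
  by (simp add: iter_diff_append del: append.simps)

lemma iter_diff_invariant:
  assumes "invariant_under G B f" "B \<subseteq> carrier G" "set xs \<subseteq> carrier G"
  shows "invariant_under G B (iter_diff G xs f)"
  using assms(3)
proof (induction xs)
  case (Cons x xs)
  have IH: "iter_diff G xs f (h \<otimes> b) = iter_diff G xs f h" if "h \<in> carrier G" "b \<in> B" for h b
    using Cons that by (simp add: invariant_under_def)
  have "iter_diff G (x # xs) f (h \<otimes> b) = iter_diff G (x # xs) f h"
    if h: "h \<in> carrier G" and b: "b \<in> B" for h b
  proof -
    have "h \<otimes> b \<otimes> x = h \<otimes> x \<otimes> b" using h b Cons.prems assms(2) by (simp add: m_ac subset_iff)
    then show ?thesis using IH[OF h b] IH[of "h \<otimes> x" b] h b Cons.prems by simp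
  qed
  then show ?case unfolding invariant_under_def by blast
qed (use assms(1) in simp)

lemma kills_base:
  assumes "B \<subseteq> carrier G"
  shows "kills G B B 1"
  unfolding kills_def
proof (intro allI impI)
  fix f xs h
  assume f: "invariant_under G B f" and xs: "set xs \<subseteq> B" "1 \<le> length xs" and h: "h \<in> carrier G"
  obtain x ys where x: "xs = x # ys" using xs(2) by (cases xs) auto
  have "invariant_under G B (iter_diff G ys f)"
    by (rule iter_diff_invariant[OF f assms]) (use xs x assms in auto)
  then show "iter_diff G xs f h = 0" using x xs h by (simp add: invariant_under_def)
qed

text \<open>
  In characteristic three, the third power of the operator for \<open>e\<close> is \<open>1 - T ^ 3\<close> with \<open>T\<close> the
  translation by \<open>e\<close>.
\<close>

lemma iter_diff_cube:
  assumes "e \<in> carrier G" "e \<otimes> e \<otimes> e = \<one>" "h \<in> carrier G"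
  shows "iter_diff G (e # e # e # xs) f h = 0"
proof -
  have "h \<otimes> e \<otimes> e \<otimes> e = h" using assms by (simp add: m_assoc)
  then have "iter_diff G (e # e # e # xs) f h =
      3 * (iter_diff G xs f (h \<otimes> e \<otimes> e) - iter_diff G xs f (h \<otimes> e))"
    by (simp add: algebra_simps)
  then show ?thesis by simp
qed

text \<open>
  Adjoining an element \<open>e\<close> with \<open>e ^ 3 = 1\<close> raises the number of operators by two. By repeated
  use of \<open>D (k e) = D k + T D e\<close>, with \<open>T\<close> the translation by \<open>k\<close>, every operator splits into
  one for an element of \<open>K\<close> and one for \<open>e\<close>, and at most two operators for \<open>e\<close> occur in a
  nonzero product.
\<close>

lemma kills_step:
  assumes B: "B \<subseteq> K" and K: "K \<subseteq> carrier G" and e: "e \<in> carrier G" "e \<otimes> e \<otimes> e = \<one>"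
    and kills: "kills G B K n"
  shows "kills G B {k \<otimes> d | k d. k \<in> K \<and> d \<in> {\<one>, e, e \<otimes> e}} (n + 2)" (is "kills G B ?K' _")
proof -
  \<comment> \<open>The elements of \<open>xs\<close> are still to be split; \<open>ys\<close> and the copies of \<open>e\<close> are the parts obtained so far.\<close>
  have main: "iter_diff G (xs @ ys @ replicate j e) f h = 0"
    if "invariant_under G B f" "set xs \<subseteq> ?K'" "set ys \<subseteq> K" "h \<in> carrier G"
      "n + 2 \<le> length xs + length ys + j" for f xs ys j h
    using that(2-5)
  proof (induction xs arbitrary: ys j h)
    case Nil
    have rep: "set (replicate j e) \<subseteq> carrier G" using e by auto
    show ?case
    proof (cases "3 \<le> j")
      case True
      then obtain j' where "j = 3 + j'" using le_Suc_ex by blast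
      then have "j = Suc (Suc (Suc j'))" by simp
      then have "iter_diff G (replicate j e) f h = 0" if "h \<in> carrier G" for h
        using iter_diff_cube[OF e that] by simp
      then have "iter_diff G ys (iter_diff G (replicate j e) f) h = iter_diff G ys (\<lambda>_. 0) h"
        by (intro iter_diff_cong) (use Nil K in auto)
      also have "iter_diff G zs (\<lambda>_. 0) h = 0" for zs h by (induction zs arbitrary: h) auto
      finally show ?thesis by (simp add: iter_diff_append)
    next
      case False
      then have "n \<le> length ys" using Nil by simp
      moreover have "invariant_under G B (iter_diff G (replicate j e) f)"
        by (rule iter_diff_invariant[OF that(1) _ rep]) (use B K in auto)
      ultimately show ?thesis using kills Nil unfolding kills_def by (simp add: iter_diff_append)
    qed
  next
    case (Cons x xs)
    obtain k d where x: "x = k \<otimes> d" "k \<in> K" "d \<in> {\<one>, e, e \<otimes> e}" using Cons.prems by auto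
    have kG: "k \<in> carrier G" and dG: "d \<in> carrier G" using x K e by auto
    have xsG: "set xs \<subseteq> carrier G" using Cons.prems(1) K e by auto
    let ?zs = "ys @ replicate j e"
    let ?g = "iter_diff G (xs @ ?zs) f"
    have all: "set (xs @ ?zs) \<subseteq> carrier G" using xsG Cons.prems K e by auto
    have dk: "?g h' - ?g (h' \<otimes> k) = 0" if "h' \<in> carrier G" for h'
    proof -
      have "?g h' - ?g (h' \<otimes> k) = iter_diff G (k # xs @ ?zs) f h'" by simp
      also have "\<dots> = iter_diff G (xs @ k # ?zs) f h'"
        by (rule iter_diff_move[OF kG all that])
      also have "\<dots> = 0" using Cons.IH[of "k # ys" h' j] Cons.prems x(2) that by simp
      finally show ?thesis .
    qed
    have de: "?g h' - ?g (h' \<otimes> e) = 0" if "h' \<in> carrier G" for h'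
    proof -
      have "?g h' - ?g (h' \<otimes> e) = iter_diff G (e # (xs @ ys) @ replicate j e) f h'" by simp
      also have "\<dots> = iter_diff G ((xs @ ys) @ e # replicate j e) f h'"
        by (rule iter_diff_move[OF e(1) _ that]) (use all in simp)
      also have "\<dots> = 0" using Cons.IH[of ys h' "Suc j"] Cons.prems that by simp
      finally show ?thesis .
    qed
    have hG: "h \<in> carrier G" by (rule Cons.prems(3))
    have "?g (h \<otimes> d) = ?g h"
      using x(3) de[OF hG] de[of "h \<otimes> e"] hG e(1) by (auto simp: m_assoc)
    moreover have "?g (h \<otimes> d \<otimes> k) = ?g (h \<otimes> d)" using dk[of "h \<otimes> d"] hG dG by simp
    moreover have "h \<otimes> x = h \<otimes> d \<otimes> k" using x kG dG hG by (simp add: m_ac)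
    ultimately show ?case by simp
  qed
  show ?thesis
    unfolding kills_def using main[of _ _ "[]" _ 0] by simp
qed

lemma subgroup_extend:
  assumes K: "subgroup K G" and e: "e \<in> carrier G" "e \<otimes> e \<otimes> e = \<one>"
  shows "subgroup {k \<otimes> d | k d. k \<in> K \<and> d \<in> {\<one>, e, e \<otimes> e}} G"
proof -
  have inv_e: "inv e = e \<otimes> e" by (rule inv_equality) (use e in auto)
  have eee: "e \<otimes> (e \<otimes> e) = \<one>" using e by (simp add: m_assoc)
  have ee: "e \<otimes> e \<in> carrier G" using e by simp
  have C: "subgroup {\<one>, e, e \<otimes> e} G"
  proof (rule subgroupI)
    have inv_ee: "inv (e \<otimes> e) = e" by (rule inv_equality) (use e eee in auto)
    show "inv a \<in> {\<one>, e, e \<otimes> e}" if "a \<in> {\<one>, e, e \<otimes> e}" for a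
      using that inv_e inv_ee by auto
    have "e \<otimes> e \<otimes> (e \<otimes> e) = e" using e eee by (metis m_assoc ee r_one)
    then show "a \<otimes> b \<in> {\<one>, e, e \<otimes> e}" if "a \<in> {\<one>, e, e \<otimes> e}" "b \<in> {\<one>, e, e \<otimes> e}" for a b
      using that e eee ee by auto
  qed (use e in auto)
  have "{k \<otimes> d | k d. k \<in> K \<and> d \<in> {\<one>, e, e \<otimes> e}} = K <#> {\<one>, e, e \<otimes> e}"
    unfolding set_mult_def by blast
  then show ?thesis using mult_subgroups[OF K C] by simp
qed

lemma card_extend:
  assumes K: "subgroup K G" "finite K" and e: "e \<in> carrier G" "e \<otimes> e \<otimes> e = \<one>" "e \<notin> K"
  shows "card {k \<otimes> d | k d. k \<in> K \<and> d \<in> {\<one>, e, e \<otimes> e}} = 3 * card K"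
proof -
  let ?C = "{\<one>, e, e \<otimes> e}"
  have KG: "k \<in> carrier G" if "k \<in> K" for k using K(1) that by (rule subgroup.mem_carrier)
  have ee: "e \<otimes> e \<notin> K"
  proof
    assume "e \<otimes> e \<in> K"
    then have "(e \<otimes> e) \<otimes> (e \<otimes> e) \<in> K" using K(1) by (simp add: subgroup.m_closed)
    moreover have "(e \<otimes> e) \<otimes> (e \<otimes> e) = e" using e by (metis m_assoc m_closed r_one)
    ultimately show False using e by simp
  qed
  have ne: "e \<noteq> \<one>" "e \<otimes> e \<noteq> \<one>" "e \<otimes> e \<noteq> e"
    using e ee subgroup.one_closed[OF K(1)] by auto
  have diff: "d = d'" if "k \<in> K" "k' \<in> K" "d \<in> ?C" "d' \<in> ?C" "k \<otimes> d = k' \<otimes> d'" for k k' d d'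
  proof -
    have dG: "d \<in> carrier G" "d' \<in> carrier G" using that(3,4) e by auto
    have "inv k \<otimes> (k \<otimes> d) \<otimes> inv d' = inv k \<otimes> (k' \<otimes> d') \<otimes> inv d'" using that(5) by simp
    moreover have "inv k \<otimes> (k \<otimes> d) = d"
      using KG[OF that(1)] dG by (simp add: m_assoc[symmetric])
    moreover have "inv k \<otimes> (k' \<otimes> d') \<otimes> inv d' = inv k \<otimes> k'"
      using KG[OF that(1)] KG[OF that(2)] dG by (simp add: m_assoc)
    ultimately have "d \<otimes> inv d' = inv k \<otimes> k'" by simp
    moreover have "inv k \<otimes> k' \<in> K" using K(1) that by (simp add: subgroup.m_closed subgroup.m_inv_closed)
    ultimately have dd: "d \<otimes> inv d' \<in> K" by simp
    have inv_e: "inv e = e \<otimes> e" by (rule inv_equality) (use e in auto)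
    have inv_ee: "inv (e \<otimes> e) = e" by (rule inv_equality) (use e in \<open>auto simp: m_assoc\<close>)
    have e4: "e \<otimes> e \<otimes> (e \<otimes> e) = e" using e by (metis m_assoc m_closed r_one)
    have "inv \<one> = \<one>" by simp
    then show ?thesis using dd that(3,4) e(1,3) ee inv_e inv_ee e4 by (elim insertE emptyE) auto
  qed
  have "inj_on (\<lambda>(k, d). k \<otimes> d) (K \<times> ?C)"
  proof (rule inj_onI, clarify)
    fix k d k' d' assume a: "k \<in> K" "d \<in> ?C" "k' \<in> K" "d' \<in> ?C" "k \<otimes> d = k' \<otimes> d'"
    then have "d = d'" using diff by blast
    then show "k = k' \<and> d = d'" using a KG e by auto
  qed
  then have "card ((\<lambda>(k, d). k \<otimes> d) ` (K \<times> ?C)) = card K * card ?C"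
    by (simp add: card_image card_cartesian_product)
  moreover have "(\<lambda>(k, d). k \<otimes> d) ` (K \<times> ?C) = {k \<otimes> d | k d. k \<in> K \<and> d \<in> ?C}" by auto
  moreover have "card ?C = 3" using ne by (simp add: card_insert_if)
  ultimately show ?thesis by simp
qed

lemma kills_carrier:
  assumes exp3: "\<And>x. x \<in> carrier G \<Longrightarrow> x \<otimes> x \<otimes> x = \<one>" and fin: "finite (carrier G)"
  shows "subgroup K G \<Longrightarrow> B \<subseteq> K \<Longrightarrow> kills G B K n \<Longrightarrow> card (carrier G) = 3 ^ j * card K \<Longrightarrow>
    kills G B (carrier G) (n + 2 * j)"
proof (induction j arbitrary: K n)
  case 0
  then have "K = carrier G" using fin by (simp add: card_subset_eq subgroup.subset)
  then show ?case using 0 by simp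
next
  case (Suc j)
  have Kc: "K \<subseteq> carrier G" using Suc.prems(1) by (rule subgroup.subset)
  have fK: "finite K" using Kc fin finite_subset by blast
  have "card K > 0" using fK subgroup.one_closed[OF Suc.prems(1)] by (auto simp: card_gt_0_iff)
  moreover have "(1::nat) < 3 ^ Suc j" by (rule one_less_power) simp_all
  ultimately have "1 * card K < 3 ^ Suc j * card K" by (intro mult_strict_right_mono)
  then have "K \<noteq> carrier G" using Suc.prems(4) by fastforce
  then obtain e where e: "e \<in> carrier G" "e \<notin> K" using Kc by blast
  let ?K' = "{k \<otimes> d | k d. k \<in> K \<and> d \<in> {\<one>, e, e \<otimes> e}}"
  have "K \<subseteq> ?K'"
  proof
    fix k assume "k \<in> K"
    then have "k = k \<otimes> \<one>" using Kc by auto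
    then show "k \<in> ?K'" using \<open>k \<in> K\<close> by blast
  qed
  have "kills G B (carrier G) (n + 2 + 2 * j)"
  proof (rule Suc.IH)
    show "subgroup ?K' G" by (rule subgroup_extend[OF Suc.prems(1) e(1) exp3[OF e(1)]])
    show "B \<subseteq> ?K'" using \<open>K \<subseteq> ?K'\<close> Suc.prems(2) by blast
    show "kills G B ?K' (n + 2)" by (rule kills_step[OF Suc.prems(2) Kc e(1) exp3[OF e(1)] Suc.prems(3)])
    show "card (carrier G) = 3 ^ j * card ?K'"
      using card_extend[OF Suc.prems(1) fK e(1) exp3[OF e(1)] e(2)] Suc.prems(4) by simp
  qed
  then show ?case by simp
qed

lemma sum_Pow_insert:
  assumes "finite F" "i \<notin> F"
  shows "(\<Sum>K\<in>Pow (insert i F). w K) = (\<Sum>K\<in>Pow F. w K) + (\<Sum>K\<in>Pow F. w (insert i K) :: f3)"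
proof -
  have "Pow F \<inter> insert i ` Pow F = {}" using assms by auto
  then have "(\<Sum>K\<in>Pow (insert i F). w K) = (\<Sum>K\<in>Pow F. w K) + (\<Sum>K\<in>insert i ` Pow F. w K)"
    unfolding Pow_insert using assms by (subst sum.union_disjoint) auto
  moreover have "inj_on (insert i) (Pow F)" using assms(2) by (auto intro!: inj_onI)
  ultimately show ?thesis by (simp add: sum.reindex)
qed

lemma signed_sum_iter_diff:
  assumes "finite I" "g \<in> I \<rightarrow> carrier G"
  shows "\<exists>xs. length xs = card I \<and> set xs \<subseteq> carrier G \<and>
    (\<forall>h \<in> carrier G. (\<Sum>K\<in>Pow I. (- 1) ^ card K * f (h \<otimes> finprod G g K)) = iter_diff G xs f h)"
  using assms
proof (induction I)
  case (insert i F)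
  have gF: "g \<in> F \<rightarrow> carrier G" and gi: "g i \<in> carrier G" using insert.prems by auto
  obtain xs where xs: "length xs = card F" "set xs \<subseteq> carrier G"
    "\<forall>h \<in> carrier G. (\<Sum>K\<in>Pow F. (- 1) ^ card K * f (h \<otimes> finprod G g K)) = iter_diff G xs f h"
    using insert.IH[OF gF] by blast
  have "(\<Sum>K\<in>Pow (insert i F). (- 1) ^ card K * f (h \<otimes> finprod G g K)) = iter_diff G (g i # xs) f h"
    if h: "h \<in> carrier G" for h
  proof -
    have "(- 1) ^ card (insert i K) * f (h \<otimes> finprod G g (insert i K)) =
        - ((- 1) ^ card K * f (h \<otimes> g i \<otimes> finprod G g K))" if "K \<in> Pow F" for K
    proof -
      have K: "finite K" "i \<notin> K" "g \<in> K \<rightarrow> carrier G" using that insert.hyps gF finite_subset by auto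
      have "h \<otimes> finprod G g (insert i K) = h \<otimes> g i \<otimes> finprod G g K"
        using K gi h by (simp add: finprod_insert m_assoc finprod_closed)
      then show ?thesis using K by simp
    qed
    then have "(\<Sum>K\<in>Pow F. (- 1) ^ card (insert i K) * f (h \<otimes> finprod G g (insert i K))) =
        - iter_diff G xs f (h \<otimes> g i)"
      using xs(3) h gi by (simp add: sum_negf)
    then show ?thesis using xs(3) h insert.hyps by (simp add: sum_Pow_insert)
  qed
  then show ?case using xs insert.hyps gi by (intro exI[of _ "g i # xs"]) auto
qed (auto intro!: exI[of _ "[]"])

text \<open>
  For the trivial subgroup \<open>B\<close> and the indicator function of the unit this bounds the Davenport
  constant: a sequence of length \<open>2 n + 1\<close> over the elementary abelian group of order \<open>3 ^ n\<close>
  has a nonempty subsequence with product one.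
\<close>

theorem signed_subset_sum:
  assumes exp3: "\<And>x. x \<in> carrier G \<Longrightarrow> x \<otimes> x \<otimes> x = \<one>" and fin: "finite (carrier G)"
    and B: "subgroup B G" "card (carrier G) = 3 ^ n * card B" "invariant_under G B f"
    and I: "finite I" "card I \<ge> 2 * n + 1" "g \<in> I \<rightarrow> carrier G" and h: "h \<in> carrier G"
  shows "(\<Sum>K\<in>Pow I. (- 1) ^ card K * f (h \<otimes> finprod G g K)) = 0"
proof -
  have "kills G B (carrier G) (1 + 2 * n)"
    using kills_carrier[OF exp3 fin B(1) _ kills_base[OF subgroup.subset[OF B(1)]] B(2)] by simp
  then show ?thesis
    using signed_sum_iter_diff[OF I(1,3), of f] B(3) I(2) h unfolding kills_def by auto
qed

end

section \<open>Values of orderings\<close>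

text \<open>The sum of \<open>\<omega> x y\<close> over all pairs of entries with \<open>x\<close> before \<open>y\<close>.\<close>

fun order_value :: "vec list \<Rightarrow> f3" where
  "order_value [] = 0"
| "order_value (x # xs) = omega x (sum_list xs) + order_value xs"

lemma order_value_append:
  "order_value (xs @ ys) = order_value xs + order_value ys + omega (sum_list xs) (sum_list ys)"
  by (induction xs) (simp_all add: omega_add_left omega_add_right algebra_simps)

lemma order_value_orthogonal:
  assumes "\<And>x y. x \<in> set xs \<Longrightarrow> y \<in> set xs \<Longrightarrow> omega x y = 0"
  shows "order_value xs = 0"
  using assms
proof (induction xs)
  case (Cons x xs)
  have "omega x (sum_list ys) = 0" if "set ys \<subseteq> set xs" for ys
    using that by (induction ys) (simp_all add: omega_add_right Cons.prems)
  then show ?case using Cons by simp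
qed simp

text \<open>
  The listed elements are the values of the six orderings of three vectors with pairwise forms
  \<open>x\<close>, \<open>y\<close>, \<open>z\<close>. They exhaust the field unless at most one form is nonzero or the vectors form a
  cyclic triangle.
\<close>

lemma triple_values:
  fixes x y z :: f3
  assumes "\<exists>e. e \<notin> {x + z + y, - x + y + z, z + x - y, y - x - z, - z - y + x, - y - z - x}"
  shows "(x = 0 \<and> y = 0) \<or> (y = 0 \<and> z = 0) \<or> (x = 0 \<and> z = 0) \<or> (x = y \<and> z = - x)"
proof -
  have "\<forall>e::f3. e = F0 \<or> e = F1 \<or> e = F2" using f3.exhaust by blast
  then show ?thesis using assms
    by (cases x; cases y; cases z) (auto simp: zero_f3_def minus_f3_def)
qed

lemma pair_values:
  fixes x y r :: f3
  assumes "x \<noteq> 0" "y \<noteq> 0"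
  shows "e \<in> {x + y + r, - x + y + r, x - y + r, - x - y + r}"
  using assms by (cases x; cases y; cases r; cases e) (simp_all add: zero_f3_def minus_f3_def)

text \<open>The values of the orderings of the vectors \<open>u i\<close> with \<open>i\<close> in \<open>K\<close>.\<close>

definition attained :: "('i \<Rightarrow> vec) \<Rightarrow> 'i set \<Rightarrow> f3 set" where
  "attained u K = {order_value (map u xs) | xs. distinct xs \<and> set xs = K}"

text \<open>
  Rearranging only the indices in \<open>S\<close>, placed in front of all others, changes the value as it
  does for \<open>S\<close> alone; \<open>r\<close> is the constant contribution of the others.
\<close>

lemma attained_front:
  assumes "finite K" "S \<subseteq> K"
  shows "\<exists>r. \<forall>xs. distinct xs \<and> set xs = S \<longrightarrow> order_value (map u xs) + r \<in> attained u K"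
proof -
  obtain ys where ys: "distinct ys" "set ys = K - S"
    using finite_distinct_list assms(1) by (metis finite_Diff)
  define r where "r = order_value (map u ys) + omega (\<Sum>i\<in>S. u i) (sum_list (map u ys))"
  have "order_value (map u xs) + r \<in> attained u K" if "distinct xs" "set xs = S" for xs
  proof -
    have "distinct (xs @ ys)" "set (xs @ ys) = K" using that ys assms(2) by auto
    moreover have "order_value (map u (xs @ ys)) = order_value (map u xs) + r"
      using that by (simp add: order_value_append r_def sum_list_distinct_conv_sum_set add.assoc)
    ultimately show ?thesis unfolding attained_def by (metis (mono_tags, lifting) mem_Collect_eq)
  qed
  then show ?thesis by blast
qed

definition cyclic_triple :: "vec \<Rightarrow> vec \<Rightarrow> vec \<Rightarrow> bool" where
  "cyclic_triple a b k \<longleftrightarrow> omega a b = 1 \<and> omega b k = 1 \<and> omega k a = 1"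

text \<open>
  Three of the vectors form a cyclic triangle, and the others are orthogonal to all vectors
  indexed by \<open>K\<close>.
\<close>

definition bad :: "('i \<Rightarrow> vec) \<Rightarrow> 'i set \<Rightarrow> bool" where
  "bad u K \<longleftrightarrow> (\<exists>i \<in> K. \<exists>j \<in> K. \<exists>k \<in> K. cyclic_triple (u i) (u j) (u k) \<and>
    (\<forall>l \<in> K - {i, j, k}. \<forall>m \<in> K. omega (u l) (u m) = 0))"

lemma one_neq_minus_one: "(1::f3) \<noteq> - 1" "(1::f3) \<noteq> 0" "- 1 \<noteq> (0::f3)"
  by (simp_all add: one_f3_def zero_f3_def)

lemma two_edges_cyclic:
  assumes "finite K" "attained u K \<noteq> UNIV" "i \<in> K" "j \<in> K" "k \<in> K"
    and ij: "omega (u i) (u j) \<noteq> 0" and ik: "omega (u i) (u k) \<noteq> 0" and jk: "j \<noteq> k"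
  shows "omega (u i) (u j) = omega (u j) (u k) \<and> omega (u i) (u k) = - omega (u i) (u j)"
proof -
  have d: "i \<noteq> j" "i \<noteq> k" using ij ik by auto
  obtain r where r: "\<And>xs. distinct xs \<Longrightarrow> set xs = {i, j, k} \<Longrightarrow> order_value (map u xs) + r \<in> attained u K"
    using attained_front[OF assms(1), of "{i, j, k}" u] assms(3-5) by auto
  obtain e where e: "e \<notin> attained u K" using assms(2) by blast
  define x y z where "x = omega (u i) (u j)" "y = omega (u j) (u k)" "z = omega (u i) (u k)"
  have sw: "omega (u j) (u i) = - x" "omega (u k) (u j) = - y" "omega (u k) (u i) = - z"
    unfolding x_y_z_def by (rule omega_swap)+
  have "e - r \<notin> {x + z + y, - x + y + z, z + x - y, y - x - z, - z - y + x, - y - z - x}"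
  proof
    assume "e - r \<in> {x + z + y, - x + y + z, z + x - y, y - x - z, - z - y + x, - y - z - x}"
    moreover have "order_value (map u [i, j, k]) = x + z + y" "order_value (map u [j, i, k]) = - x + y + z"
      "order_value (map u [i, k, j]) = z + x - y" "order_value (map u [j, k, i]) = y - x - z"
      "order_value (map u [k, i, j]) = - z - y + x" "order_value (map u [k, j, i]) = - y - z - x"
      by (simp_all add: omega_add_right sw) (simp_all add: x_y_z_def)
    moreover have "order_value (map u xs) \<noteq> e - r" if "distinct xs" "set xs = {i, j, k}" for xs
      using r[OF that] e by auto
    ultimately show False using d jk
      by (elim insertE emptyE)
         (metis (no_types, lifting) distinct_length_2_or_more distinct_singleton insert_commute list.simps(15) empty_set)+
  qed
  then have "(x = 0 \<and> y = 0) \<or> (y = 0 \<and> z = 0) \<or> (x = 0 \<and> z = 0) \<or> (x = y \<and> z = - x)"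
    by (intro triple_values) blast
  then show ?thesis using ij ik unfolding x_y_z_def by auto
qed

lemma disjoint_edges_full:
  assumes "finite K" "i \<in> K" "j \<in> K" "k \<in> K" "l \<in> K"
    and ij: "omega (u i) (u j) \<noteq> 0" and kl: "omega (u k) (u l) \<noteq> 0"
    and d: "i \<noteq> k" "i \<noteq> l" "j \<noteq> k" "j \<noteq> l"
  shows "attained u K = UNIV"
proof -
  have d': "i \<noteq> j" "k \<noteq> l" using ij kl by auto
  obtain r where r: "\<And>xs. distinct xs \<Longrightarrow> set xs = {i, j, k, l} \<Longrightarrow> order_value (map u xs) + r \<in> attained u K"
    using attained_front[OF assms(1), of "{i, j, k, l}" u] assms(2-5) by auto
  define x y z where "x = omega (u i) (u j)" "y = omega (u k) (u l)" "z = omega (u i + u j) (u k + u l)"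
  have sw: "omega (u j) (u i) = - x" "omega (u l) (u k) = - y"
    unfolding x_y_z_def by (rule omega_swap)+
  have ov: "order_value (map u [i, j, k, l]) + r = x + y + (z + r)"
    "order_value (map u [j, i, k, l]) + r = - x + y + (z + r)"
    "order_value (map u [i, j, l, k]) + r = x - y + (z + r)"
    "order_value (map u [j, i, l, k]) + r = - x - y + (z + r)"
    by (simp_all add: omega_add_right omega_add_left sw x_y_z_def(3))
       (simp_all add: x_y_z_def algebra_simps)
  have "e \<in> attained u K" for e
  proof -
    have "e \<in> {x + y + (z + r), - x + y + (z + r), x - y + (z + r), - x - y + (z + r)}"
      by (rule pair_values) (use ij kl x_y_z_def in auto)
    moreover have "distinct [i, j, k, l]" "distinct [j, i, k, l]" "distinct [i, j, l, k]" "distinct [j, i, l, k]"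
      using d d' by auto
    moreover have "set [j, i, k, l] = {i, j, k, l}" "set [i, j, l, k] = {i, j, k, l}" "set [j, i, l, k] = {i, j, k, l}"
      by auto
    ultimately show ?thesis using r[of "[i, j, k, l]"] r[of "[j, i, k, l]"] r[of "[i, j, l, k]"] r[of "[j, i, l, k]"]
      unfolding ov by auto
  qed
  then show ?thesis by blast
qed

text \<open>
  As the vectors sum up to zero, \<open>u i\<close> is not orthogonal to some \<open>u k\<close> besides \<open>u j\<close>. Since some
  value is not attained, \<open>i\<close>, \<open>j\<close>, \<open>k\<close> form a cyclic triangle, and no other pair of vectors
  disjoint from one of its edges can be nonorthogonal.
\<close>

lemma bad_or_full:
  assumes fin: "finite K" and sum: "(\<Sum>i\<in>K. u i) = 0"
    and edge: "i \<in> K" "j \<in> K" "omega (u i) (u j) \<noteq> 0" and nf: "attained u K \<noteq> UNIV"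
  shows "bad u K"
proof -
  have "omega (u i) (\<Sum>l\<in>S. u l) = (\<Sum>l\<in>S. omega (u i) (u l))" if "finite S" for S
    using that by (induction S) (simp_all add: omega_add_right)
  then have s0: "(\<Sum>l\<in>K. omega (u i) (u l)) = 0" using sum fin by (metis omega_zero(2))
  have "\<exists>k \<in> K. k \<noteq> j \<and> omega (u i) (u k) \<noteq> 0"
  proof (rule ccontr)
    assume "\<not> ?thesis"
    then have "(\<Sum>l\<in>K - {j}. omega (u i) (u l)) = 0" by (intro sum.neutral) auto
    then show False using s0 edge(3) sum.remove[OF fin edge(2), of "\<lambda>l. omega (u i) (u l)"] by simp
  qed
  then obtain k where k: "k \<in> K" "k \<noteq> j" "omega (u i) (u k) \<noteq> 0" by blast
  have c: "omega (u i) (u j) = omega (u j) (u k)" "omega (u i) (u k) = - omega (u i) (u j)"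
    using two_edges_cyclic[OF fin nf edge(1,2) k(1) edge(3) k(3) k(2)[symmetric]] by blast+
  have ki: "omega (u k) (u i) = omega (u i) (u j)" using c(2) omega_swap[of "u k" "u i"] by simp
  have jk: "omega (u j) (u k) \<noteq> 0" using c edge by simp
  have d: "i \<noteq> j" "i \<noteq> k" "j \<noteq> k" using edge k jk by auto
  have rest: "omega (u l) (u m) = 0" if l: "l \<in> K - {i, j, k}" and m: "m \<in> K" for l m
  proof (rule ccontr)
    assume n: "omega (u l) (u m) \<noteq> 0"
    have K: "i \<in> K" "j \<in> K" "k \<in> K" "l \<in> K" using edge k l by auto
    have dl: "l \<noteq> i" "l \<noteq> j" "l \<noteq> k" using l by auto
    consider "m = i" | "m \<noteq> i" "m = j" | "m \<noteq> i" "m \<noteq> j" by blast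
    then have "attained u K = UNIV"
    proof cases
      case 1
      then show ?thesis using disjoint_edges_full[OF fin K(4) m K(2,3) n jk] dl d by blast
    next
      case 2
      have "omega (u k) (u i) \<noteq> 0" using ki edge by simp
      then show ?thesis using disjoint_edges_full[OF fin K(4) m K(3,1) n] 2 dl d by blast
    next
      case 3
      then show ?thesis using disjoint_edges_full[OF fin K(4) m K(1,2) n edge(3)] dl d by blast
    qed
    then show False using nf by simp
  qed
  show ?thesis
  proof (cases "omega (u i) (u j) = 1")
    case True
    then have "cyclic_triple (u i) (u j) (u k)" using c ki by (simp add: cyclic_triple_def)
    then show ?thesis unfolding bad_def using rest edge k by blast
  next
    case False
    then have "omega (u i) (u j) = - 1"
      using edge(3) by (cases "omega (u i) (u j)") (simp_all add: zero_f3_def one_f3_def)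
    then have "cyclic_triple (u j) (u i) (u k)"
      using c ki omega_swap[of "u j" "u i"] omega_swap[of "u k" "u j"] by (simp add: cyclic_triple_def)
    moreover have "K - {j, i, k} = K - {i, j, k}" by blast
    ultimately show ?thesis unfolding bad_def using rest edge k by metis
  qed
qed

lemma bad_attained:
  assumes fin: "finite K" and bad: "bad u K"
  shows "1 \<in> attained u K" "- 1 \<in> attained u K"
proof -
  obtain i j k where K: "i \<in> K" "j \<in> K" "k \<in> K" and c: "cyclic_triple (u i) (u j) (u k)"
    and rest: "\<And>l m. l \<in> K - {i, j, k} \<Longrightarrow> m \<in> K \<Longrightarrow> omega (u l) (u m) = 0"
    using bad unfolding bad_def by blast
  have s: "omega (u i) (u j) = 1" "omega (u j) (u k) = 1" "omega (u k) (u i) = 1"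
    "omega (u j) (u i) = - 1" "omega (u i) (u k) = - 1"
    using c omega_swap[of "u j" "u i"] omega_swap[of "u i" "u k"] unfolding cyclic_triple_def by simp_all
  have d: "i \<noteq> j" "j \<noteq> k" "i \<noteq> k" using s one_neq_minus_one by auto
  obtain ys where ys: "distinct ys" "set ys = K - {i, j, k}" using finite_distinct_list fin by (metis finite_Diff)
  have r0: "order_value (map u ys) = 0"
    by (rule order_value_orthogonal) (use ys rest in auto)
  have r1: "omega x (sum_list (map u zs)) = 0" if "x \<in> u ` K" "set zs \<subseteq> K - {i, j, k}" for x zs
    using that(2)
  proof (induction zs)
    case (Cons z zs)
    have "omega (u z) x = 0" using rest Cons that(1) by auto
    then have "omega x (u z) = 0" using omega_swap[of x "u z"] by simp
    then show ?case using Cons by (simp add: omega_add_right)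
  qed simp
  have ov: "order_value (map u (xs @ ys)) = order_value (map u xs)" if "set xs \<subseteq> K" for xs
  proof -
    have "omega (sum_list (map u xs)) (sum_list (map u ys)) = 0"
      using that r1[of _ ys] ys by (induction xs) (simp_all add: omega_add_left)
    then show ?thesis by (simp add: order_value_append r0)
  qed
  have "order_value (map u [i, j, k]) = 1" "order_value (map u [j, i, k]) = - 1"
    using s by (simp_all add: omega_add_right)
  then have "order_value (map u ([i, j, k] @ ys)) = 1" "order_value (map u ([j, i, k] @ ys)) = - 1"
    using ov[of "[i, j, k]"] ov[of "[j, i, k]"] K by (simp_all del: map_append order_value.simps)
  moreover have "distinct ([i, j, k] @ ys)" "distinct ([j, i, k] @ ys)"
    "set ([i, j, k] @ ys) = K" "set ([j, i, k] @ ys) = K" using d ys K by auto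
  ultimately show "1 \<in> attained u K" "- 1 \<in> attained u K" unfolding attained_def by (metis (mono_tags, lifting) mem_Collect_eq)+
qed

section \<open>Bad sets and weights of triangles\<close>

text \<open>
  A product-one-free sequence \<open>g\<close>, described in the abelian group: here \<open>G\<close> is the abelian
  group, \<open>cp\<close> the embedding of the field onto the center of \<open>E\<close>, and \<open>v\<close> the projection to \<open>V\<close>.
  The last assumption says that no nonempty set of terms can be ordered to have product one in
  the original group.
\<close>

locale free_sequence = comm_group +
  fixes cp :: "f3 \<Rightarrow> 'a" and v :: "'a \<Rightarrow> vec" and I :: "'i set" and g :: "'i \<Rightarrow> 'a" and n :: nat
  assumes finite_G: "finite (carrier G)" and order_G: "card (carrier G) = 3 ^ Suc n"
    and cube: "\<And>x. x \<in> carrier G \<Longrightarrow> x \<otimes> x \<otimes> x = \<one>"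
    and cp_closed: "\<And>x. cp x \<in> carrier G" and cp_add: "\<And>x y. cp (x + y) = cp x \<otimes> cp y"
    and cp_inj: "inj cp"
    and v_mult: "\<And>x y. x \<in> carrier G \<Longrightarrow> y \<in> carrier G \<Longrightarrow> v (x \<otimes> y) = v x + v y"
    and v_cp: "\<And>x. v (cp x) = 0"
    and finite_I: "finite I" and card_I: "card I = 2 * Suc n + 1" and g_closed: "g \<in> I \<rightarrow> carrier G"
    and few: "card {i \<in> I. v (g i) \<noteq> 0} \<le> 12"
    and free: "\<And>K x. K \<subseteq> I \<Longrightarrow> K \<noteq> {} \<Longrightarrow> x \<in> attained (v \<circ> g) K \<Longrightarrow> finprod G g K \<noteq> cp x"
begin

abbreviation u :: "'i \<Rightarrow> vec" where "u \<equiv> v \<circ> g"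
abbreviation prd :: "'i set \<Rightarrow> 'a" where "prd \<equiv> finprod G g"

text \<open>The sign is an element of the field with three elements.\<close>

definition psign :: "'i set \<Rightarrow> f3" where "psign K = (- 1) ^ card K"

text \<open>The bad sets with abelian product one.\<close>

definition \<B> :: "'i set set" where "\<B> = {K. K \<subseteq> I \<and> bad u K \<and> prd K = \<one>}"

lemma cp_zero: "cp 0 = \<one>"
  using cp_add[of 0 0] cp_closed[of 0] by (metis add.right_neutral r_cancel_one')

lemma finite_sub: "K \<subseteq> I \<Longrightarrow> finite K"
  using finite_I finite_subset by blast

lemma prd_closed: "K \<subseteq> I \<Longrightarrow> prd K \<in> carrier G"
  using g_closed by (intro finprod_closed) auto

lemma v_one: "v \<one> = 0"
  using v_mult[of \<one> \<one>] by simp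

lemma v_prd: "K \<subseteq> I \<Longrightarrow> v (prd K) = (\<Sum>i\<in>K. u i)"
proof -
  assume "K \<subseteq> I"
  then have "finite K" by (rule finite_sub)
  then show ?thesis using \<open>K \<subseteq> I\<close>
  proof (induction K)
    case (insert i K)
    have "g i \<in> carrier G" "g \<in> K \<rightarrow> carrier G" "prd K \<in> carrier G" using insert.prems g_closed prd_closed by auto
    then show ?case using insert by (simp add: finprod_insert v_mult)
  qed (simp add: v_one)
qed

lemma attained_nonfull:
  assumes "K \<subseteq> I" "K \<noteq> {}" "prd K \<in> range cp"
  shows "attained u K \<noteq> UNIV"
  using free[OF assms(1,2)] assms(3) by blast

text \<open>The product is \<open>cp x\<close>, and \<open>x\<close> is none of the attained values \<open>1\<close> and \<open>-1\<close>.\<close>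

lemma bad_of_central_product:
  assumes K: "K \<subseteq> I" "prd K \<in> range cp" and edge: "i \<in> K" "j \<in> K" "omega (u i) (u j) \<noteq> 0"
  shows "K \<in> \<B>"
proof -
  have ne: "K \<noteq> {}" using edge by blast
  have "(\<Sum>i\<in>K. u i) = 0" using v_prd[OF K(1)] K(2) v_cp by auto
  then have b: "bad u K"
    using bad_or_full[OF finite_sub[OF K(1)] _ edge attained_nonfull[OF K(1) ne K(2)]] by blast
  obtain x where x: "prd K = cp x" using K(2) by blast
  have "x \<noteq> 1" "x \<noteq> - 1" using free[OF K(1) ne] bad_attained[OF finite_sub[OF K(1)] b] x by auto
  then have "x = 0" by (cases x) (simp_all add: zero_f3_def one_f3_def)
  then show ?thesis using b K x cp_zero by (simp add: \<B>_def)
qed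

lemma abelian_product:
  assumes K: "K \<subseteq> I" "K \<noteq> {}" and ab: "\<And>i j. i \<in> K \<Longrightarrow> j \<in> K \<Longrightarrow> omega (u i) (u j) = 0"
  shows "prd K \<noteq> \<one>"
proof -
  obtain xs where xs: "distinct xs" "set xs = K" using finite_distinct_list finite_sub K(1) by blast
  have "order_value (map u xs) = 0" by (rule order_value_orthogonal) (use xs ab in auto)
  then have "0 \<in> attained u K" using xs unfolding attained_def by force
  then show ?thesis using free[OF K] cp_zero by metis
qed

lemma finite_\<B>: "finite \<B>"
  by (rule finite_subset[of _ "Pow I"]) (auto simp: \<B>_def finite_I)

lemma sum_sign_bad: "(\<Sum>K\<in>\<B>. psign K) = - 1"
proof -
  let ?f = "\<lambda>x. if x = \<one> then 1 else (0::f3)"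
  have "invariant_under G {\<one>} ?f" by (simp add: invariant_under_def)
  then have "(\<Sum>K\<in>Pow I. (- 1) ^ card K * ?f (\<one> \<otimes> prd K)) = 0"
    using signed_subset_sum[OF cube finite_G triv_subgroup _ _ finite_I _ g_closed one_closed, of "Suc n" ?f]
      order_G card_I by simp
  moreover have "(\<Sum>K\<in>Pow I. (- 1) ^ card K * ?f (\<one> \<otimes> prd K)) = (\<Sum>K\<in>Pow I. if prd K = \<one> then psign K else 0)"
    by (rule sum.cong) (auto simp: psign_def prd_closed)
  ultimately have "(\<Sum>K\<in>{K \<in> Pow I. prd K = \<one>}. psign K) = 0"
    unfolding sum.inter_filter[OF finite_Pow_iff[THEN iffD2, OF finite_I]] by simp
  moreover have "{K \<in> Pow I. prd K = \<one>} = insert {} \<B>"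
  proof (intro equalityI subsetI)
    fix K assume K: "K \<in> {K \<in> Pow I. prd K = \<one>}"
    then have K': "K \<subseteq> I" "prd K = \<one>" by auto
    show "K \<in> insert {} \<B>"
    proof (cases "\<exists>i\<in>K. \<exists>j\<in>K. omega (u i) (u j) \<noteq> 0")
      case True
      then show ?thesis using bad_of_central_product[OF K'(1)] K'(2) cp_zero by (metis insertI2 rangeI)
    next
      case False
      then have "K = {}" using abelian_product[OF K'(1)] K'(2) by blast
      then show ?thesis by simp
    qed
  qed (auto simp: \<B>_def)
  moreover have "{} \<notin> \<B>" by (auto simp: \<B>_def bad_def)
  ultimately have "psign {} + (\<Sum>K\<in>\<B>. psign K) = 0" using finite_\<B> by simp
  then have "1 + (\<Sum>K\<in>\<B>. psign K) = 0" by (simp add: psign_def)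
  then show ?thesis by (simp only: eq_neg_iff_add_eq_0 add.commute)
qed

lemma subgroup_cp: "subgroup (range cp) G"
proof (rule subgroupI)
  show "inv a \<in> range cp" if a: "a \<in> range cp" for a
  proof -
    obtain x where x: "a = cp x" using a by blast
    have "cp (- x) \<otimes> cp x = \<one>" using cp_add[of "- x" x] cp_zero by simp
    then have "inv a = cp (- x)" using x cp_closed by (simp add: inv_equality)
    then show ?thesis by simp
  qed
  show "a \<otimes> b \<in> range cp" if ab: "a \<in> range cp" "b \<in> range cp" for a b
  proof -
    obtain x y where "a = cp x" "b = cp y" using ab by blast
    then show ?thesis using cp_add[of x y] by (metis rangeI)
  qed
qed (use cp_closed in auto)

lemma card_cp: "card (range cp) = 3"
  using cp_inj by (simp add: card_image card_f3)

text \<open>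
  The subsets of the remaining terms are tested for product in \<open>range cp\<close>. This subgroup
  accounts for one factor three, that is, for the two terms that are removed.
\<close>

lemma sum_sign_pair:
  assumes ij: "i \<in> I" "j \<in> I" "omega (u i) (u j) \<noteq> 0"
  shows "(\<Sum>K\<in>{K \<in> \<B>. i \<in> K \<and> j \<in> K}. psign K) = 0"
proof -
  have ne: "i \<noteq> j" using ij by auto
  let ?I = "I - {i, j}"
  let ?f = "\<lambda>x. if x \<in> range cp then 1 else (0::f3)"
  have gij: "g i \<in> carrier G" "g j \<in> carrier G" "g \<in> ?I \<rightarrow> carrier G" using g_closed ij by auto
  have inv: "invariant_under G (range cp) ?f"
  proof -
    have "h \<otimes> b \<in> range cp \<longleftrightarrow> h \<in> range cp" if "h \<in> carrier G" "b \<in> range cp" for h b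
    proof
      assume "h \<otimes> b \<in> range cp"
      then have "h \<otimes> b \<otimes> inv b \<in> range cp"
        using that subgroup.m_closed[OF subgroup_cp] subgroup.m_inv_closed[OF subgroup_cp] by blast
      moreover have "b \<in> carrier G" using that cp_closed by auto
      ultimately show "h \<in> range cp" using that by (simp add: m_assoc)
    qed (use that subgroup.m_closed[OF subgroup_cp] in blast)
    then show ?thesis by (simp add: invariant_under_def)
  qed
  have "card ?I = card I - 2" using ij ne by (simp add: card_Diff_subset)
  then have cI: "2 * n + 1 \<le> card ?I" using card_I by simp
  have 0: "(\<Sum>K\<in>Pow ?I. (- 1) ^ card K * ?f (g i \<otimes> g j \<otimes> prd K)) = 0"
    by (rule signed_subset_sum[OF cube finite_G subgroup_cp _ inv _ cI gij(3)])
       (use order_G card_cp finite_I gij in auto)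
  have ins: "prd (insert i (insert j K)) = g i \<otimes> g j \<otimes> prd K" "card (insert i (insert j K)) = card K + 2"
    if "K \<in> Pow ?I" for K
  proof -
    have KI: "K \<subseteq> I" using that by auto
    have K: "finite K" "i \<notin> K" "j \<notin> K" "g \<in> K \<rightarrow> carrier G" "prd K \<in> carrier G"
      using that gij finite_sub[OF KI] prd_closed[OF KI] by auto
    then show "prd (insert i (insert j K)) = g i \<otimes> g j \<otimes> prd K" "card (insert i (insert j K)) = card K + 2"
      using ne gij by (simp_all add: finprod_insert m_assoc)
  qed
  have "(\<Sum>K\<in>{K \<in> \<B>. i \<in> K \<and> j \<in> K}. psign K) =
      (\<Sum>K\<in>{K \<in> Pow ?I. g i \<otimes> g j \<otimes> prd K \<in> range cp}. psign (insert i (insert j K)))"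
  proof (rule sum.reindex_bij_witness[of _ "\<lambda>K. insert i (insert j K)" "\<lambda>K. K - {i, j}"])
    fix K assume K: "K \<in> {K \<in> \<B>. i \<in> K \<and> j \<in> K}"
    have e: "insert i (insert j (K - {i, j})) = K" using K by auto
    then show "insert i (insert j (K - {i, j})) = K" "psign (insert i (insert j (K - {i, j}))) = psign K" by simp_all
    have "K - {i, j} \<in> Pow ?I" using K by (auto simp: \<B>_def)
    moreover have "prd K = \<one>" using K by (simp add: \<B>_def)
    ultimately show "K - {i, j} \<in> {K \<in> Pow ?I. g i \<otimes> g j \<otimes> prd K \<in> range cp}"
      using ins(1)[of "K - {i, j}"] e cp_zero by (metis (no_types, lifting) mem_Collect_eq rangeI)
  next
    fix K assume K: "K \<in> {K \<in> Pow ?I. g i \<otimes> g j \<otimes> prd K \<in> range cp}"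
    then show "insert i (insert j K) - {i, j} = K" by auto
    have "insert i (insert j K) \<in> \<B>"
      by (rule bad_of_central_product[of _ i j]) (use K ins ij in auto)
    then show "insert i (insert j K) \<in> {K \<in> \<B>. i \<in> K \<and> j \<in> K}" by simp
  qed
  also have "\<dots> = (\<Sum>K\<in>{K \<in> Pow ?I. g i \<otimes> g j \<otimes> prd K \<in> range cp}. (- 1) ^ card K)"
    by (rule sum.cong) (simp_all add: psign_def ins)
  also have "\<dots> = (\<Sum>K\<in>Pow ?I. (- 1) ^ card K * ?f (g i \<otimes> g j \<otimes> prd K))"
    unfolding sum.inter_filter[OF finite_Pow_iff[THEN iffD2, OF finite_Diff[OF finite_I]]]
    by (rule sum.cong) simp_all
  finally show ?thesis using 0 by simp
qed

text \<open>The triangle of a bad set: the vectors of its terms that do not commute with all the others.\<close>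

definition support :: "'i set \<Rightarrow> vec set" where
  "support K = {u i | i. i \<in> K \<and> (\<exists>j \<in> K. omega (u i) (u j) \<noteq> 0)}"

lemma supportE:
  assumes "K \<in> \<B>"
  obtains i j k where "i \<in> K" "j \<in> K" "k \<in> K" "cyclic_triple (u i) (u j) (u k)"
    "support K = {u i, u j, u k}"
    "\<And>l m. l \<in> K - {i, j, k} \<Longrightarrow> m \<in> K \<Longrightarrow> omega (u l) (u m) = 0"
    "\<And>l m. l \<in> K - {i, j, k} \<Longrightarrow> m \<in> K \<Longrightarrow> omega (u m) (u l) = 0"
proof -
  obtain i j k where K: "i \<in> K" "j \<in> K" "k \<in> K" and c: "cyclic_triple (u i) (u j) (u k)"
    and rest: "\<forall>l \<in> K - {i, j, k}. \<forall>m \<in> K. omega (u l) (u m) = 0"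
    using assms unfolding \<B>_def bad_def by blast
  have "omega (u i) (u j) \<noteq> 0" "omega (u j) (u k) \<noteq> 0" "omega (u k) (u i) \<noteq> 0"
    using c one_neq_minus_one unfolding cyclic_triple_def by auto
  then have "support K = {u i, u j, u k}"
    using K rest unfolding support_def by blast
  moreover have "omega (u m) (u l) = 0" if "l \<in> K - {i, j, k}" "m \<in> K" for l m
    using rest that omega_swap[of "u m" "u l"] by simp
  ultimately show thesis using that K c rest by blast
qed

text \<open>A vertex of the triangle belongs to a single term of the bad set.\<close>

lemma support_index_unique:
  assumes K: "K \<in> \<B>" and i: "i \<in> K" "i' \<in> K" "u i = u i'" "u i \<in> support K"
  shows "i = i'"
proof -
  obtain a b k where c: "a \<in> K" "b \<in> K" "k \<in> K" "cyclic_triple (u a) (u b) (u k)"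
    and sup: "support K = {u a, u b, u k}"
    and rest: "\<And>l m. l \<in> K - {a, b, k} \<Longrightarrow> m \<in> K \<Longrightarrow> omega (u l) (u m) = 0"
    using supportE[OF K] by metis
  have nz: "\<exists>m \<in> K. omega x (u m) \<noteq> 0" if "x \<in> support K" for x
  proof -
    have "omega (u a) (u b) \<noteq> 0" "omega (u b) (u k) \<noteq> 0" "omega (u k) (u a) \<noteq> 0"
      using c(4) one_neq_minus_one unfolding cyclic_triple_def by auto
    then show ?thesis using that c(1-3) unfolding sup by blast
  qed
  have mem: "l \<in> {a, b, k}" if "l \<in> K" "u l \<in> support K" for l
    using nz[OF that(2)] rest[of l] that(1) by blast
  have ne: "u a \<noteq> u b" "u b \<noteq> u k" "u a \<noteq> u k"
    using c(4) one_neq_minus_one unfolding cyclic_triple_def by auto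
  show ?thesis using mem[of i] mem[of i'] i ne by auto
qed

text \<open>The total sign of the bad sets with a given triangle.\<close>

definition weight :: "vec set \<Rightarrow> f3" where
  "weight t = (\<Sum>K\<in>{K \<in> \<B>. support K = t}. psign K)"

lemma sum_weight_edge:
  assumes ab: "omega a b \<noteq> 0"
  shows "(\<Sum>t\<in>{t \<in> support ` \<B>. a \<in> t \<and> b \<in> t}. weight t) = 0"
proof -
  let ?A = "{i \<in> I. u i = a} \<times> {j \<in> I. u j = b}"
  let ?S = "\<lambda>(i, j). {K \<in> \<B>. i \<in> K \<and> j \<in> K}"
  let ?C = "{K \<in> \<B>. a \<in> support K \<and> b \<in> support K}"
  have C: "?C = (\<Union>p\<in>?A. ?S p)"
  proof (intro equalityI subsetI)
    fix K assume K: "K \<in> ?C"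
    then have "\<exists>i\<in>K. u i = a" "\<exists>j\<in>K. u j = b" by (auto simp: support_def)
    moreover have "K \<subseteq> I" using K by (simp add: \<B>_def)
    ultimately show "K \<in> (\<Union>p\<in>?A. ?S p)" using K by blast
  next
    fix K assume "K \<in> (\<Union>p\<in>?A. ?S p)"
    then obtain i j where ij: "K \<in> \<B>" "i \<in> K" "j \<in> K" "u i = a" "u j = b" by blast
    moreover have "omega b a \<noteq> 0" using ab omega_swap[of b a] by simp
    ultimately show "K \<in> ?C" using ab unfolding support_def by blast
  qed
  have "(\<Sum>K\<in>?C. psign K) = (\<Sum>p\<in>?A. \<Sum>K\<in>?S p. psign K)"
    unfolding C
  proof (rule sum.UNION_disjoint)
    show "finite ?A" using finite_I by simp
    show "\<forall>p\<in>?A. finite (?S p)" using finite_\<B> by auto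
    show "\<forall>p\<in>?A. \<forall>q\<in>?A. p \<noteq> q \<longrightarrow> ?S p \<inter> ?S q = {}"
    proof (intro ballI impI)
      fix p q assume pq: "p \<in> ?A" "q \<in> ?A" "p \<noteq> q"
      obtain i j i' j' where e: "p = (i, j)" "q = (i', j')" by (cases p; cases q)
      show "?S p \<inter> ?S q = {}"
      proof (rule ccontr)
        assume "\<not> ?thesis"
        then obtain K where K: "K \<in> \<B>" "i \<in> K" "j \<in> K" "i' \<in> K" "j' \<in> K" using e by auto
        have "K \<in> ?C" unfolding C using K pq e by blast
        then have "i = i'" "j = j'"
          using support_index_unique[OF K(1,2,4)] support_index_unique[OF K(1,3,5)] pq e by auto
        then show False using pq e by simp
      qed
    qed
  qed
  also have "\<dots> = 0"
    by (rule sum.neutral) (use sum_sign_pair ab in auto)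
  finally have 0: "(\<Sum>K\<in>?C. psign K) = 0" .
  have "(\<Sum>K\<in>?C. psign K) = (\<Sum>t\<in>support ` ?C. \<Sum>K\<in>{K \<in> ?C. support K = t}. psign K)"
    by (rule sum.image_gen) (use finite_\<B> in simp)
  also have "\<dots> = (\<Sum>t\<in>{t \<in> support ` \<B>. a \<in> t \<and> b \<in> t}. weight t)"
  proof (rule sum.cong)
    show "support ` ?C = {t \<in> support ` \<B>. a \<in> t \<and> b \<in> t}" by auto
    fix t assume "t \<in> {t \<in> support ` \<B>. a \<in> t \<and> b \<in> t}"
    then show "(\<Sum>K\<in>{K \<in> ?C. support K = t}. psign K) = weight t"
      unfolding weight_def by (intro sum.cong) auto
  qed
  finally show ?thesis using 0 by simp
qed

lemma sum_weight: "(\<Sum>t\<in>support ` \<B>. weight t) = - 1"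
  using sum.image_gen[OF finite_\<B>, of psign support] sum_sign_bad by (simp add: weight_def)

section \<open>Active triangles and their lines\<close>

text \<open>Cyclically oriented triangles of nonzero weight.\<close>

definition active :: "vec \<Rightarrow> vec \<Rightarrow> vec \<Rightarrow> bool" where
  "active a b k \<longleftrightarrow> cyclic_triple a b k \<and> weight {a, b, k} \<noteq> 0"

lemma weight_support: "weight t \<noteq> 0 \<Longrightarrow> t \<in> support ` \<B>"
proof (rule ccontr)
  assume "weight t \<noteq> 0" "t \<notin> support ` \<B>"
  then have "{K \<in> \<B>. support K = t} = {}" by blast
  then have "weight t = 0" unfolding weight_def by (simp only: sum.empty)
  then show False using \<open>weight t \<noteq> 0\<close> by simp
qed

lemma active_rotate: "active a b k \<Longrightarrow> active b k a"
  by (simp add: active_def cyclic_triple_def insert_commute)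

lemma cyclic_tripleD:
  assumes "cyclic_triple a b k"
  shows "omega a b = 1" "omega b k = 1" "omega k a = 1" "omega b a = - 1" "omega k b = - 1" "omega a k = - 1"
  using assms omega_swap[of b a] omega_swap[of k b] omega_swap[of a k] by (simp_all add: cyclic_triple_def)

lemma cyclic_triple_distinct:
  assumes "cyclic_triple a b k"
  shows "a \<noteq> b" "b \<noteq> k" "a \<noteq> k"
  using cyclic_tripleD[OF assms] one_neq_minus_one by auto

lemma cyclic_edge_third:
  assumes "cyclic_triple a b k" "x \<in> {a, b, k}" "y \<in> {a, b, k}" "omega x y = 1"
  shows "\<exists>z. cyclic_triple x y z \<and> {x, y, z} = {a, b, k}"
proof -
  note D = cyclic_tripleD[OF assms(1)]
  have "(x, y) = (a, b) \<or> (x, y) = (b, k) \<or> (x, y) = (k, a)"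
    using assms(2-4) D one_neq_minus_one by auto
  then show ?thesis using assms(1) by (auto simp: cyclic_triple_def)
qed

lemma weight_active:
  assumes "weight t \<noteq> 0" "x \<in> t" "y \<in> t" "omega x y = 1"
  shows "\<exists>z. active x y z \<and> t = {x, y, z}"
proof -
  obtain K where K: "K \<in> \<B>" "t = support K" using weight_support[OF assms(1)] by blast
  obtain i j k where c: "cyclic_triple (u i) (u j) (u k)" "support K = {u i, u j, u k}"
    using supportE[OF K(1)] by metis
  obtain z where "cyclic_triple x y z" "{x, y, z} = t"
    using cyclic_edge_third[OF c(1) _ _ assms(4)] assms(2,3) K(2) c(2) by auto
  then show ?thesis using assms(1) by (auto simp: active_def)
qed

lemma weight_edge:
  assumes "weight t \<noteq> 0" "x \<in> t" "y \<in> t" "x \<noteq> y"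
  shows "omega x y = 1 \<or> omega y x = 1"
proof -
  obtain K where K: "K \<in> \<B>" "t = support K" using weight_support[OF assms(1)] by blast
  obtain i j k where c: "cyclic_triple (u i) (u j) (u k)" "support K = {u i, u j, u k}"
    using supportE[OF K(1)] by metis
  show ?thesis using cyclic_tripleD[OF c(1)] assms K c(2) by auto
qed

text \<open>The weights on an edge sum up to zero, so a nonzero weight does not stay alone.\<close>

lemma active_other:
  assumes "active a b k"
  shows "\<exists>k'. active a b k' \<and> k' \<noteq> k"
proof (rule ccontr)
  assume n: "\<not> ?thesis"
  have ab: "omega a b = 1" using assms by (simp add: active_def cyclic_triple_def)
  let ?T = "{t \<in> support ` \<B>. a \<in> t \<and> b \<in> t}"
  have w: "weight {a, b, k} \<noteq> 0" using assms by (simp add: active_def)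
  have "weight t = 0" if t: "t \<in> ?T - {{a, b, k}}" for t
  proof (rule ccontr)
    assume "weight t \<noteq> 0"
    then obtain z where "active a b z" "t = {a, b, z}" using weight_active[OF _ _ _ ab] t by blast
    then show False using n t by blast
  qed
  then have "(\<Sum>t\<in>?T. weight t) = (\<Sum>t\<in>{{a, b, k}}. weight t)"
    using finite_\<B> weight_support[OF w] by (intro sum.mono_neutral_right) auto
  moreover have "(\<Sum>t\<in>?T. weight t) = 0" by (rule sum_weight_edge) (simp add: ab)
  ultimately show False using w by simp
qed

lemma sum_multiples:
  assumes "finite R" "\<And>m. m \<in> R \<Longrightarrow> x m = 0 \<or> x m = s" "card {m \<in> R. x m = s} \<le> 1"
  shows "(\<Sum>m\<in>R. x m) = 0 \<or> (\<Sum>m\<in>R. x m) = (s :: vec)"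
proof -
  have "(\<Sum>m\<in>R. x m) = (\<Sum>m\<in>{m \<in> R. x m = s}. x m)"
    using assms(1,2) by (intro sum.mono_neutral_right) auto
  also have "\<dots> = 0 \<or> \<dots> = s"
  proof (cases "{m \<in> R. x m = s} = {}")
    case False
    then obtain m where m: "m \<in> R" "x m = s" by blast
    have "{m \<in> R. x m = s} = {m}"
    proof (rule card_subset_eq[symmetric])
      have "card {m \<in> R. x m = s} > 0" using False assms(1) by (simp add: card_gt_0_iff)
      then show "card {m} = card {m \<in> R. x m = s}" using assms(3) by simp
    qed (use assms(1) m in auto)
    then show ?thesis using m by simp
  next
    case True
    show ?thesis unfolding True by simp
  qed
  finally show ?thesis .
qed

text \<open>The indices of the noncentral terms.\<close>

definition J :: "'i set" where "J = {i \<in> I. u i \<noteq> 0}"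

text \<open>
  The terms of a bad set outside its triangle are orthogonal to \<open>a\<close>, \<open>b\<close> and \<open>s = a + b + k\<close>,
  hence they are multiples of \<open>s\<close>; their sum is \<open>- s\<close>.
\<close>

lemma active_sum:
  assumes act: "active a b k" and nz: "a + b + k \<noteq> 0"
  shows "- (a + b + k) \<in> u ` J \<or> card {i \<in> J. u i = a + b + k} \<ge> 2"
proof -
  define s where "s = a + b + k"
  have c: "cyclic_triple a b k" using act by (simp add: active_def)
  note D = cyclic_tripleD[OF c]
  obtain K where K: "K \<in> \<B>" "support K = {a, b, k}"
    using act weight_support[of "{a, b, k}"] by (auto simp: active_def)
  obtain i j l where ijl: "i \<in> K" "j \<in> K" "l \<in> K" "cyclic_triple (u i) (u j) (u l)"
    "support K = {u i, u j, u l}"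
    and rest: "\<And>p m. p \<in> K - {i, j, l} \<Longrightarrow> m \<in> K \<Longrightarrow> omega (u m) (u p) = 0"
    using supportE[OF K(1)] by metis
  have KI: "K \<subseteq> I" "finite K" using K(1) finite_sub by (auto simp: \<B>_def)
  have d: "i \<noteq> j" "j \<noteq> l" "i \<noteq> l" using cyclic_triple_distinct[OF ijl(4)] by auto
  have abk: "{u i, u j, u l} = {a, b, k}" using K(2) ijl(5) by simp
  have dd: "u i \<noteq> u j" "u j \<noteq> u l" "u i \<noteq> u l" "a \<noteq> b" "b \<noteq> k" "a \<noteq> k"
    using cyclic_triple_distinct[OF ijl(4)] cyclic_triple_distinct[OF c] by auto
  have "(\<Sum>x\<in>{u i, u j, u l}. x) = (\<Sum>x\<in>{a, b, k}. x)" unfolding abk by (rule refl)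
  then have s3: "u i + u j + u l = s" using dd by (simp add: s_def add.assoc)
  let ?R = "K - {i, j, l}"
  have "(\<Sum>m\<in>K. u m) = 0"
    using v_prd[OF KI(1)] K(1) by (simp add: \<B>_def v_one)
  moreover have "(\<Sum>m\<in>K. u m) = (\<Sum>m\<in>?R. u m) + (\<Sum>m\<in>{i, j, l}. u m)"
    by (rule sum.subset_diff) (use ijl KI in auto)
  ultimately have sR: "(\<Sum>m\<in>?R. u m) = - s"
    using d s3 by (simp add: add.assoc eq_neg_iff_add_eq_0)
  have mult: "u m = 0 \<or> u m = s \<or> u m = - s" if m: "m \<in> ?R" for m
  proof (rule orthogonal_plane[OF D(1)])
    have o: "omega x (u m) = 0" if "x \<in> {a, b, k}" for x
      using that rest[OF m] ijl(1-3) unfolding abk[symmetric] by auto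
    then show "omega a (u m) = 0" "omega b (u m) = 0" by simp_all
    show "omega s (u m) = 0" using o by (simp add: s_def omega_add_left)
    show "omega a s = 0" "omega b s = 0" using D by (simp_all add: s_def omega_add_right)
    show "s \<noteq> 0" using nz by (simp add: s_def)
  qed
  have s0: "s \<noteq> 0" using nz by (simp add: s_def)
  show ?thesis
  proof (rule ccontr)
    assume n: "\<not> ?thesis"
    have RJ: "m \<in> J" if "m \<in> ?R" "u m \<noteq> 0" for m using that KI by (auto simp: J_def)
    have "u m = 0 \<or> u m = s" if m: "m \<in> ?R" for m
    proof (rule ccontr)
      assume "\<not> ?thesis"
      then have "u m = - s" using mult[OF m] by blast
      moreover from this have "m \<in> J" using RJ[OF m] s0 by simp
      ultimately have "- s \<in> u ` J" by (metis image_eqI)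
      then show False using n s_def by simp
    qed
    moreover have "card {m \<in> ?R. u m = s} \<le> 1"
    proof -
      have "{m \<in> ?R. u m = s} \<subseteq> {i \<in> J. u i = s}" using RJ s0 by auto
      moreover have "finite {i \<in> J. u i = s}" using finite_I by (simp add: J_def)
      ultimately have "card {m \<in> ?R. u m = s} \<le> card {i \<in> J. u i = s}" by (rule card_mono[rotated])
      then show ?thesis using n by (simp add: s_def)
    qed
    ultimately have "(\<Sum>m\<in>?R. u m) = 0 \<or> (\<Sum>m\<in>?R. u m) = s"
      by (intro sum_multiples) (use KI in auto)
    then show False using sR s0 vec_neg_eq_self[of s] by auto
  qed
qed

lemma active_mem: "active a b k \<Longrightarrow> a \<in> u ` J"
proof -
  assume act: "active a b k"
  then obtain K where K: "K \<in> \<B>" "support K = {a, b, k}"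
    using weight_support[of "{a, b, k}"] by (auto simp: active_def)
  then have "a \<in> support K" by simp
  then obtain i where "i \<in> K" "u i = a" by (auto simp: support_def)
  moreover have "a \<noteq> 0" using act one_neq_minus_one by (auto simp: active_def cyclic_triple_def)
  ultimately show ?thesis using K(1) by (force simp: J_def \<B>_def)
qed

sublocale active_complex active J u
proof
  show "finite J" using finite_I by (simp add: J_def)
  show "card J \<le> 12" using few by (simp add: J_def)
  show "u i \<noteq> 0" if "i \<in> J" for i using that by (simp add: J_def)
  show "omega a b = 1" if "active a b k" for a b k using that by (simp add: active_def cyclic_triple_def)
qed (fact active_rotate active_mem active_other active_sum)+

text \<open>
  The set of all multiples of the vertex sums of the active triangles that have an edge in \<open>t\<close>.
  For an active triangle \<open>t\<close> it is a subspace of dimension at most one. All edges of \<open>t\<close> are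
  taken into account, because a triangle of sum zero does not determine a line by itself.
\<close>

definition line :: "vec set \<Rightarrow> vec set" where
  "line t = insert 0 {s. \<exists>x y k. active x y k \<and> x \<in> t \<and> y \<in> t \<and> (s = x + y + k \<or> s = - (x + y + k))}"

lemma active_sums_parallel:
  assumes t1: "active x y k1" and t2: "active x' y' k2"
    and xy: "(x', y') = (x, y) \<or> (x', y') = (y, - (x + y)) \<or> (x', y') = (- (x + y), x)"
    and nz: "x + y + k1 \<noteq> 0"
  shows "x' + y' + k2 \<in> {0, x + y + k1, - (x + y + k1)}"
proof -
  have o': "omega x' (x' + y' + k2) = 0" "omega y' (x' + y' + k2) = 0" using act_orthogonal[OF t2] by blast+
  have o: "omega x (x' + y' + k2) = 0 \<and> omega y (x' + y' + k2) = 0"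
    using xy o' by (auto simp: omega_minus_left omega_diff_left)
  have "x' + y' + k2 = 0 \<or> x' + y' + k2 = x + y + k1 \<or> x' + y' + k2 = - (x + y + k1)"
    by (rule orthogonal_plane[OF act_omega[OF t1] act_orthogonal[OF t1] nz _ _ no_two_lines[OF t1 t2 xy]])
       (use o in auto)
  then show ?thesis by blast
qed

lemma active_edges:
  assumes "active a b k" "x \<in> {a, b, k}" "y \<in> {a, b, k}" "omega x y = 1"
  shows "(x, y) = (a, b) \<or> (x, y) = (b, k) \<or> (x, y) = (k, a)"
  using assms(2-4) cyclic_tripleD[of a b k] assms(1) one_neq_minus_one by (auto simp: active_def)

lemma line_subset:
  assumes "\<And>x y k. active x y k \<Longrightarrow> x \<in> t \<Longrightarrow> y \<in> t \<Longrightarrow> x + y + k \<in> {0, s, - s}"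
  shows "line t \<subseteq> {0, s, - s}"
proof
  fix z assume "z \<in> line t"
  then consider "z = 0" | w where "w \<in> {0, s, - s}" "z = w \<or> z = - w"
    using assms unfolding line_def by blast
  then show "z \<in> {0, s, - s}" by cases auto
qed

lemma line_form:
  assumes act: "active a b k"
  shows "\<exists>s. line {a, b, k} = {0, s, - s} \<and> (\<forall>x \<in> {a, b, k}. omega x s = 0)"
proof -
  let ?t = "{a, b, k}"
  have orth: "omega z (x + y + l) = 0" if "active x y l" "x \<in> ?t" "y \<in> ?t" "z \<in> ?t" "a + b + k = 0" for x y z l
  proof -
    have e: "(x, y) = (a, b) \<or> (x, y) = (b, k) \<or> (x, y) = (k, a)"
      using active_edges[OF act that(2,3) act_omega[OF that(1)]] .
    have k: "k = - (a + b)" by (rule minus_unique[OF that(5), symmetric])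
    have "omega x (x + y + l) = 0" "omega y (x + y + l) = 0" using act_orthogonal[OF that(1)] by blast+
    then show ?thesis using e that(4) unfolding k by (auto simp: omega_minus_left omega_diff_left)
  qed
  show ?thesis
  proof (cases "a + b + k = 0")
    case False
    let ?s = "a + b + k"
    have "x + y + l \<in> {0, ?s, - ?s}" if xyl: "active x y l" "x \<in> ?t" "y \<in> ?t" for x y l
    proof -
      have e: "(x, y) = (a, b) \<or> (x, y) = (b, k) \<or> (x, y) = (k, a)"
        using active_edges[OF act xyl(2,3) act_omega[OF xyl(1)]] .
      obtain m where m: "active x y m" "x + y + m = ?s"
        using e act active_rotate[OF act] active_rotate[OF active_rotate[OF act]] by (auto simp: ac_simps)
      show ?thesis using active_sums_parallel[OF m(1) xyl(1)] m(2) False by simp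
    qed
    then have "line ?t \<subseteq> {0, ?s, - ?s}" by (rule line_subset)
    moreover have "?s \<in> line ?t" "- ?s \<in> line ?t" "0 \<in> line ?t" using act unfolding line_def by blast+
    ultimately have "line ?t = {0, ?s, - ?s}" by blast
    moreover have "\<forall>x \<in> ?t. omega x ?s = 0"
      using act_orthogonal[OF act] act_orthogonal_third[OF act] by blast
    ultimately show ?thesis by blast
  next
    case True
    have k: "k = - (a + b)" by (rule minus_unique[OF True, symmetric])
    show ?thesis
    proof (cases "\<forall>x y l. active x y l \<longrightarrow> x \<in> ?t \<longrightarrow> y \<in> ?t \<longrightarrow> x + y + l = 0")
      case True
      then have "line ?t \<subseteq> {0, 0, - 0}" by (intro line_subset) blast
      moreover have "0 \<in> line ?t" unfolding line_def by blast
      ultimately have "line ?t = {0, 0, - 0}" by auto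
      then show ?thesis by (intro exI[of _ 0]) simp
    next
      case False
      then obtain x y l where xyl: "active x y l" "x \<in> ?t" "y \<in> ?t" "x + y + l \<noteq> 0" by blast
      let ?s = "x + y + l"
      have e: "(x, y) = (a, b) \<or> (x, y) = (b, k) \<or> (x, y) = (k, a)"
        using active_edges[OF act xyl(2,3) act_omega[OF xyl(1)]] .
      have "x' + y' + l' \<in> {0, ?s, - ?s}" if x': "active x' y' l'" "x' \<in> ?t" "y' \<in> ?t" for x' y' l'
      proof -
        have e': "(x', y') = (a, b) \<or> (x', y') = (b, k) \<or> (x', y') = (k, a)"
          using active_edges[OF act x'(2,3) act_omega[OF x'(1)]] .
        have "(x', y') = (x, y) \<or> (x', y') = (y, - (x + y)) \<or> (x', y') = (- (x + y), x)"
          using e e' unfolding k by auto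
        then show ?thesis using active_sums_parallel[OF xyl(1) x'(1) _ xyl(4)] by blast
      qed
      then have "line ?t \<subseteq> {0, ?s, - ?s}" by (rule line_subset)
      moreover have "?s \<in> line ?t" "- ?s \<in> line ?t" "0 \<in> line ?t" using xyl unfolding line_def by blast+
      ultimately have "line ?t = {0, ?s, - ?s}" by blast
      then show ?thesis using orth[OF xyl(1-3)] True by blast
    qed
  qed
qed

text \<open>The cosets of the line that contain the vertices of the triangle.\<close>

definition cosets :: "vec set \<Rightarrow> vec set set" where
  "cosets t = (\<lambda>x. (+) x ` line t) ` t"

lemma line_add:
  assumes "L = {0, s, - s}" "l \<in> L"
  shows "(+) (x + l) ` L = (+) x ` (L :: vec set)"
proof -
  have "s + s = - s" by (rule vec_double)
  moreover have "- s - s = s" using vec_double[of "- s"] by simp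
  ultimately show ?thesis using assms by (auto simp: image_insert add.assoc algebra_simps)
qed

lemma line_diff:
  assumes "x \<in> {0, z, - z}" "y \<in> {0, z, - z}"
  shows "x - y \<in> {0, z, - z :: vec}"
proof -
  have "z + z = - z" "- z - z = z" using vec_double[of z] vec_double[of "- z"] by simp_all
  then show ?thesis using assms by auto
qed

text \<open>
  If the third vertices differ, then one of the two vertex sums is nonzero; it spans both lines,
  and the difference of the third vertices lies on it.
\<close>

lemma cosets_shared_edge:
  assumes t: "active a b k" and t': "active a b k'"
  shows "cosets {a, b, k} = cosets {a, b, k'}"
proof -
  obtain s where s: "line {a, b, k} = {0, s, - s}" using line_form[OF t] by blast
  obtain s' where s': "line {a, b, k'} = {0, s', - s'}" using line_form[OF t'] by blast
  have mem: "a + b + k \<in> line {a, b, k}" "a + b + k' \<in> line {a, b, k}"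
    "a + b + k \<in> line {a, b, k'}" "a + b + k' \<in> line {a, b, k'}"
    using t t' unfolding line_def by blast+
  show ?thesis
  proof (cases "k = k'")
    case False
    have "line {a, b, k} = {0, z, - z} \<and> line {a, b, k'} = {0, z, - z}"
      if "z \<noteq> 0" "z \<in> {a + b + k, a + b + k'}" for z
    proof -
      have "z \<in> {0, s, - s}" "z \<in> {0, s', - s'}" using that(2) mem s s' by auto
      then have "{0, z, - z} = {0, s, - s}" "{0, z, - z} = {0, s', - s'}" using that(1) by (auto simp: insert_commute)
      then show ?thesis using s s' by simp
    qed
    moreover have "a + b + k \<noteq> 0 \<or> a + b + k' \<noteq> 0" using False minus_unique by metis
    ultimately obtain z where z: "line {a, b, k} = {0, z, - z}" "line {a, b, k'} = {0, z, - z}" by blast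
    have "a + b + k' - (a + b + k) \<in> {0, z, - z}"
      by (rule line_diff) (use mem(1,2) z(1) in auto)
    then have "k' - k \<in> {0, z, - z}" by simp
    then have "(+) (k + (k' - k)) ` {0, z, - z} = (+) k ` {0, z, - z}" by (intro line_add) auto
    then have "(+) k' ` {0, z, - z} = (+) k ` {0, z, - z}" by simp
    then show ?thesis unfolding cosets_def z by simp
  qed simp
qed

text \<open>
  Let \<open>A\<close> and \<open>B\<close> be the cosets that contain \<open>a\<close> and \<open>b\<close>. An active triangle with the same
  cosets has exactly one vertex in \<open>A\<close> and one in \<open>B\<close>. For fixed vertices \<open>x\<close> in \<open>A\<close> and \<open>y\<close> in
  \<open>B\<close> the weights of the triangles through both sum up to zero.
\<close>

lemma sum_weight_cosets:
  assumes act: "active a b k"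
  shows "(\<Sum>t\<in>{t \<in> support ` \<B>. weight t \<noteq> 0 \<and> cosets t = cosets {a, b, k}}. weight t) = 0"
    (is "(\<Sum>t\<in>?T. weight t) = 0")
proof -
  define A where "A = (+) a ` line {a, b, k}"
  define B where "B = (+) b ` line {a, b, k}"
  have zero: "0 \<in> line t" for t by (simp add: line_def)
  have unique: "\<exists>!x. x \<in> t \<and> x \<in> C" and rep: "x \<in> t \<Longrightarrow> x \<in> C \<Longrightarrow> C = (+) x ` line t"
    if t: "weight t \<noteq> 0" "C \<in> cosets t" for t C x
  proof -
    obtain p q r where pqr: "active p q r" "t = {p, q, r}"
    proof -
      obtain K where K: "K \<in> \<B>" "t = support K" using weight_support[OF t(1)] by blast
      obtain i j l where "cyclic_triple (u i) (u j) (u l)" "support K = {u i, u j, u l}"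
        using supportE[OF K(1)] by metis
      then show thesis using that K t(1) by (simp add: active_def)
    qed
    obtain s where s: "line t = {0, s, - s}" "\<forall>x \<in> t. omega x s = 0"
      using line_form[OF pqr(1)] pqr(2) by blast
    obtain x0 where x0: "x0 \<in> t" "C = (+) x0 ` line t" using t(2) unfolding cosets_def by blast
    have coset: "C = (+) x ` line t" if xC: "x \<in> C" for x
    proof -
      obtain l where "x = x0 + l" "l \<in> line t" using xC x0(2) by blast
      then show ?thesis using line_add[OF s(1)] x0(2) by simp
    qed
    show "x \<in> t \<Longrightarrow> x \<in> C \<Longrightarrow> C = (+) x ` line t" using coset by blast
    have "x0 \<in> C" using x0(2) zero[of t] by force
    moreover have "y = x0" if y: "y \<in> t" "y \<in> C" for y
    proof (rule ccontr)
      assume "y \<noteq> x0"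
      then have "omega x0 y \<noteq> 0"
        using weight_edge[OF t(1) x0(1) y(1)] omega_swap[of x0 y] one_neq_minus_one by auto
      moreover obtain l where "y = x0 + l" "l \<in> {0, s, - s}" using y(2) x0(2) s(1) by blast
      ultimately show False using s(2) x0(1) by (auto simp: omega_add_right omega_minus_right omega_diff_right)
    qed
    ultimately show "\<exists>!x. x \<in> t \<and> x \<in> C" using x0(1) by blast
  qed
  have w: "weight {a, b, k} \<noteq> 0" using act by (simp add: active_def)
  have AB: "A \<in> cosets {a, b, k}" "B \<in> cosets {a, b, k}" by (simp_all add: A_def B_def cosets_def)
  have ab: "a \<noteq> b" using act cyclic_triple_distinct by (auto simp: active_def)
  have aA: "a \<in> A" "b \<in> B" unfolding A_def B_def using zero[of "{a, b, k}"] by force+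
  have neq: "A \<noteq> B" using unique[OF w AB(1)] aA ab by auto
  have tAB: "A \<in> cosets t" "B \<in> cosets t" "weight t \<noteq> 0" if "t \<in> ?T" for t using that AB by auto
  have fT: "finite ?T" using finite_\<B> by simp
  have "?T = (\<Union>(x, y)\<in>A \<times> B. {t \<in> ?T. x \<in> t \<and> y \<in> t})"
  proof (intro equalityI subsetI)
    fix t assume t: "t \<in> ?T"
    obtain x y where "x \<in> t" "x \<in> A" "y \<in> t" "y \<in> B"
      using unique[OF tAB(3)[OF t] tAB(1)[OF t]] unique[OF tAB(3)[OF t] tAB(2)[OF t]] by blast
    then show "t \<in> (\<Union>(x, y)\<in>A \<times> B. {t \<in> ?T. x \<in> t \<and> y \<in> t})" using t by blast
  qed auto
  then have "(\<Sum>t\<in>?T. weight t) = (\<Sum>t\<in>(\<Union>(x, y)\<in>A \<times> B. {t \<in> ?T. x \<in> t \<and> y \<in> t}). weight t)"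
    by (rule arg_cong)
  also have "\<dots> = (\<Sum>p\<in>A \<times> B. \<Sum>t\<in>(case p of (x, y) \<Rightarrow> {t \<in> ?T. x \<in> t \<and> y \<in> t}). weight t)"
  proof (rule sum.UNION_disjoint)
    show "finite (A \<times> B)" by simp
    show "\<forall>p\<in>A \<times> B. finite (case p of (x, y) \<Rightarrow> {t \<in> ?T. x \<in> t \<and> y \<in> t})" using fT by auto
    show "\<forall>p\<in>A \<times> B. \<forall>q\<in>A \<times> B. p \<noteq> q \<longrightarrow>
        (case p of (x, y) \<Rightarrow> {t \<in> ?T. x \<in> t \<and> y \<in> t}) \<inter> (case q of (x, y) \<Rightarrow> {t \<in> ?T. x \<in> t \<and> y \<in> t}) = {}"
    proof (intro ballI impI)
      fix p q assume pq: "p \<in> A \<times> B" "q \<in> A \<times> B" "p \<noteq> q"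
      obtain x y x' y' where e: "p = (x, y)" "q = (x', y')" by (cases p; cases q)
      have "x = x'" "y = y'" if t: "t \<in> ?T" "x \<in> t" "y \<in> t" "x' \<in> t" "y' \<in> t" for t
        using unique[OF tAB(3)[OF t(1)] tAB(1)[OF t(1)]] unique[OF tAB(3)[OF t(1)] tAB(2)[OF t(1)]] t pq e
        by auto
      then show "(case p of (x, y) \<Rightarrow> {t \<in> ?T. x \<in> t \<and> y \<in> t}) \<inter> (case q of (x, y) \<Rightarrow> {t \<in> ?T. x \<in> t \<and> y \<in> t}) = {}"
        using pq(3) e by auto
    qed
  qed
  also have "\<dots> = 0"
  proof (rule sum.neutral, intro ballI)
    fix p assume p: "p \<in> A \<times> B"
    obtain x y where xy: "p = (x, y)" by (cases p)
    have "(\<Sum>t\<in>{t \<in> ?T. x \<in> t \<and> y \<in> t}. weight t) = 0"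
    proof (cases "{t \<in> ?T. x \<in> t \<and> y \<in> t} = {}")
      case True
      show ?thesis unfolding True by simp
    next
      case False
      then obtain t where t: "t \<in> ?T" "x \<in> t" "y \<in> t" by blast
      have "x \<noteq> y"
      proof
        assume "x = y"
        then have "A = B" using rep[OF tAB(3)[OF t(1)] tAB(1)[OF t(1)] t(2)] rep[OF tAB(3)[OF t(1)] tAB(2)[OF t(1)] t(3)]
          p xy by auto
        then show False using neq by simp
      qed
      then have o: "omega x y = 1 \<or> omega y x = 1" using weight_edge[OF tAB(3)[OF t(1)] t(2,3)] by blast
      have same: "cosets t' = cosets t" if t': "weight t' \<noteq> 0" "x \<in> t'" "y \<in> t'" for t'
        using o
      proof
        assume "omega x y = 1"
        then obtain z z' where "active x y z" "t = {x, y, z}" "active x y z'" "t' = {x, y, z'}"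
          using weight_active[OF tAB(3)[OF t(1)] t(2,3)] weight_active[OF t'] by blast
        then show ?thesis using cosets_shared_edge by blast
      next
        assume "omega y x = 1"
        then obtain z z' where "active y x z" "t = {y, x, z}" "active y x z'" "t' = {y, x, z'}"
          using weight_active[OF tAB(3)[OF t(1)] t(3,2)] weight_active[OF t'(1,3,2)] by blast
        then show ?thesis using cosets_shared_edge by blast
      qed
      have "(\<Sum>t\<in>{t \<in> ?T. x \<in> t \<and> y \<in> t}. weight t) =
          (\<Sum>t\<in>{t \<in> support ` \<B>. x \<in> t \<and> y \<in> t}. weight t)"
        using finite_\<B> same t(1) by (intro sum.mono_neutral_left) auto
      also have "\<dots> = 0"
        by (rule sum_weight_edge) (use o omega_swap[of x y] one_neq_minus_one in auto)
      finally show ?thesis .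
    qed
    then show "(\<Sum>t\<in>(case p of (x, y) \<Rightarrow> {t \<in> ?T. x \<in> t \<and> y \<in> t}). weight t) = 0" using xy by simp
  qed
  finally show ?thesis .
qed

theorem contradiction: False
proof -
  let ?T = "{t \<in> support ` \<B>. weight t \<noteq> 0}"
  have fT: "finite ?T" using finite_\<B> by simp
  have "(\<Sum>t\<in>support ` \<B>. weight t) = (\<Sum>t\<in>?T. weight t)"
    using finite_\<B> by (intro sum.mono_neutral_right) auto
  also have "\<dots> = (\<Sum>Q\<in>cosets ` ?T. \<Sum>t\<in>{t \<in> ?T. cosets t = Q}. weight t)"
    by (rule sum.image_gen[OF fT])
  also have "\<dots> = 0"
  proof (rule sum.neutral, intro ballI)
    fix Q assume "Q \<in> cosets ` ?T"
    then obtain t where t: "t \<in> ?T" "Q = cosets t" by blast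
    obtain K where K: "K \<in> \<B>" "t = support K" using t by blast
    obtain i j l where "cyclic_triple (u i) (u j) (u l)" "support K = {u i, u j, u l}"
      using supportE[OF K(1)] by metis
    then have "active (u i) (u j) (u l)" "t = {u i, u j, u l}" using t K by (simp_all add: active_def)
    moreover have "{t' \<in> ?T. cosets t' = Q} = {t' \<in> support ` \<B>. weight t' \<noteq> 0 \<and> cosets t' = Q}" by blast
    ultimately show "(\<Sum>t\<in>{t \<in> ?T. cosets t = Q}. weight t) = 0"
      using sum_weight_cosets t(2) by simp
  qed
  finally show False using sum_weight one_neq_minus_one by simp
qed

end

section \<open>Coordinates on the extraspecial group\<close>

lemma card_vec: "card (UNIV :: vec set) = 81"
proof -
  have "bij_betw (\<lambda>(a, b, c, d). Vec a b c d) UNIV UNIV"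
    by (rule bij_betwI[where g = "\<lambda>x. case x of Vec a b c d \<Rightarrow> (a, b, c, d)"]) (auto split: vec.splits)
  then have "card (UNIV :: vec set) = card (UNIV :: (f3 \<times> f3 \<times> f3 \<times> f3) set)"
    by (metis bij_betw_same_card)
  also have "(UNIV :: (f3 \<times> f3 \<times> f3 \<times> f3) set) = UNIV \<times> UNIV \<times> UNIV \<times> UNIV" by simp
  finally show ?thesis by (simp only: card_cartesian_product card_f3)
qed

text \<open>
  A group in which all commutators lie in the image of an injective homomorphism \<open>cp\<close> from the
  field with three elements to the center; \<open>form x y\<close> is the exponent of the commutator of \<open>x\<close>
  and \<open>y\<close>.
\<close>

locale central_form = group +
  fixes cp :: "f3 \<Rightarrow> 'a" and form :: "'a \<Rightarrow> 'a \<Rightarrow> f3"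
  assumes cp_closed [simp]: "cp e \<in> carrier G"
    and cp_add: "cp (d + e) = cp d \<otimes> cp e" and cp_inj: "inj cp"
    and cp_central: "x \<in> carrier G \<Longrightarrow> cp e \<otimes> x = x \<otimes> cp e"
    and form: "x \<in> carrier G \<Longrightarrow> y \<in> carrier G \<Longrightarrow> x \<otimes> y = y \<otimes> x \<otimes> cp (form x y)"
begin

lemma cp_zero [simp]: "cp 0 = \<one>"
  using cp_add[of 0 0] cp_closed[of 0] by (metis add.right_neutral r_cancel_one')

lemma form_eqI:
  assumes "x \<in> carrier G" "y \<in> carrier G" "x \<otimes> y = y \<otimes> x \<otimes> cp e"
  shows "form x y = e"
proof -
  have "y \<otimes> x \<otimes> cp (form x y) = y \<otimes> x \<otimes> cp e" using form assms by metis
  then have "cp (form x y) = cp e" using assms by simp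
  then show ?thesis using cp_inj by (simp add: inj_eq)
qed

lemma form_mult_right:
  assumes [simp]: "x \<in> carrier G" "y \<in> carrier G" "z \<in> carrier G"
  shows "form x (y \<otimes> z) = form x y + form x z"
proof (rule form_eqI)
  have "x \<otimes> (y \<otimes> z) = y \<otimes> x \<otimes> cp (form x y) \<otimes> z"
    using form[of x y] by (simp flip: m_assoc)
  also have "\<dots> = y \<otimes> (x \<otimes> z) \<otimes> cp (form x y)" by (simp add: m_assoc cp_central)
  also have "\<dots> = y \<otimes> (z \<otimes> x \<otimes> cp (form x z)) \<otimes> cp (form x y)" using form[of x z] by simp
  also have "\<dots> = y \<otimes> z \<otimes> x \<otimes> (cp (form x z) \<otimes> cp (form x y))" by (simp add: m_assoc)
  also have "\<dots> = y \<otimes> z \<otimes> x \<otimes> cp (form x y + form x z)" by (simp only: cp_add[symmetric] add.commute)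
  finally show "x \<otimes> (y \<otimes> z) = y \<otimes> z \<otimes> x \<otimes> cp (form x y + form x z)" .
qed simp_all

lemma form_self [simp]: "x \<in> carrier G \<Longrightarrow> form x x = 0"
  by (rule form_eqI) simp_all

lemma form_swap:
  assumes [simp]: "x \<in> carrier G" "y \<in> carrier G"
  shows "form y x = - form x y"
proof (rule form_eqI)
  have "x \<otimes> y \<otimes> cp (- form x y) = y \<otimes> x \<otimes> cp (form x y) \<otimes> cp (- form x y)"
    using form[of x y] by simp
  also have "\<dots> = y \<otimes> x" by (simp add: m_assoc flip: cp_add)
  finally show "y \<otimes> x = x \<otimes> y \<otimes> cp (- form x y)" by simp
qed simp_all

lemma form_mult_left:
  assumes [simp]: "x \<in> carrier G" "y \<in> carrier G" "z \<in> carrier G"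
  shows "form (x \<otimes> y) z = form x z + form y z"
proof -
  have "- form (x \<otimes> y) z = - (form x z + form y z)"
    using form_mult_right[of z x y] form_swap[of "x \<otimes> y" z] form_swap[of x z] form_swap[of y z] by simp
  then show ?thesis by (simp only: neg_equal_iff_equal)
qed

lemma form_one [simp]: "x \<in> carrier G \<Longrightarrow> form \<one> x = 0" "x \<in> carrier G \<Longrightarrow> form x \<one> = 0"
  by (rule form_eqI; simp)+

lemma form_inv_right:
  assumes [simp]: "x \<in> carrier G" "y \<in> carrier G"
  shows "form x (inv y) = - form x y"
  using form_mult_right[of x "inv y" y] by (simp add: eq_neg_iff_add_eq_0)

lemma form_zero_iff:
  assumes [simp]: "x \<in> carrier G" "y \<in> carrier G"
  shows "form x y = 0 \<longleftrightarrow> x \<otimes> y = y \<otimes> x"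
  using form[of x y] form_eqI[of x y 0] by auto

lemma center_iff: "z \<in> center G \<longleftrightarrow> z \<in> carrier G \<and> (\<forall>x \<in> carrier G. form z x = 0)"
  by (auto simp: center_def form_zero_iff)

text \<open>Powers with exponents in the field with three elements.\<close>

fun pw :: "'a \<Rightarrow> f3 \<Rightarrow> 'a" where
  "pw x F0 = \<one>" | "pw x F1 = x" | "pw x F2 = x \<otimes> x"

lemma pw_closed [simp]: "x \<in> carrier G \<Longrightarrow> pw x t \<in> carrier G"
  by (cases t) simp_all

lemma form_pw_right: "x \<in> carrier G \<Longrightarrow> y \<in> carrier G \<Longrightarrow> form x (pw y t) = t * form x y"
  by (cases t) (simp_all add: form_mult_right f3_double zero_f3_def)

lemma form_pw_left: "x \<in> carrier G \<Longrightarrow> y \<in> carrier G \<Longrightarrow> form (pw x t) y = t * form x y"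
  by (cases t) (simp_all add: form_mult_left f3_double zero_f3_def)

lemma hyperbolic_partner:
  assumes "x \<in> carrier G" "x \<notin> center G"
  shows "\<exists>y \<in> carrier G. form x y = 1"
proof -
  obtain y where y: "y \<in> carrier G" "form x y \<noteq> 0" using assms center_iff by blast
  then have "form x (pw y (form x y)) = 1" using assms f3_square by (simp add: form_pw_right)
  then show ?thesis using y by (metis pw_closed)
qed

text \<open>
  Removing from \<open>h\<close> its components along \<open>x\<close> and \<open>y\<close> leaves an element orthogonal to both. If it
  were always central, the group would have at most \<open>9\<close> times as many elements as its center.
\<close>

lemma orthogonal_noncentral:
  assumes x: "x \<in> carrier G" and y: "y \<in> carrier G" and xy: "form x y = 1"
    and fin: "finite (carrier G)" and big: "9 * card (center G) < card (carrier G)"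
  shows "\<exists>z \<in> carrier G. z \<notin> center G \<and> form x z = 0 \<and> form y z = 0"
proof (rule ccontr)
  assume n: "\<not> ?thesis"
  define rep where "rep h = pw x (form h y) \<otimes> pw y (form x h)" for h
  define rem where "rem h = h \<otimes> inv (rep h)" for h
  have rep: "rep h \<in> carrier G" if "h \<in> carrier G" for h using x y by (simp add: rep_def)
  have yx: "form y x = - 1" using form_swap[OF x y] xy by simp
  have rem: "rem h \<in> center G" if h: "h \<in> carrier G" for h
  proof -
    have "form x (rem h) = 0" "form y (rem h) = 0"
      using h x y rep[OF h] xy yx form_swap[OF h y]
      by (simp_all add: rem_def form_mult_right form_inv_right)
         (simp_all add: rep_def form_mult_right form_pw_right xy yx)
    moreover have "rem h \<in> carrier G" using h rep by (simp add: rem_def)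
    ultimately show ?thesis using n by blast
  qed
  let ?F = "\<lambda>h. (form h y, form x h, rem h)"
  have "inj_on ?F (carrier G)"
  proof (rule inj_onI)
    fix h h' assume h: "h \<in> carrier G" "h' \<in> carrier G" "?F h = ?F h'"
    then have "rep h = rep h'" "rem h = rem h'" by (simp_all add: rep_def)
    then show "h = h'" using h rep by (simp add: rem_def)
  qed
  moreover have "?F ` carrier G \<subseteq> UNIV \<times> UNIV \<times> center G" using rem by auto
  moreover have "finite (center G)" using fin by (rule finite_subset[rotated]) (auto simp: center_def)
  ultimately have "card (carrier G) \<le> card ((UNIV :: f3 set) \<times> (UNIV :: f3 set) \<times> center G)"
    by (intro card_inj_on_le) auto
  also have "\<dots> = 9 * card (center G)" by (simp add: card_cartesian_product card_f3)
  finally show False using big by simp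
qed

text \<open>
  Two orthogonal hyperbolic pairs \<open>x1\<close>, \<open>y1\<close> and \<open>x2\<close>, \<open>y2\<close> give the coordinates. They are onto,
  so that by counting their kernel is not larger than the center.
\<close>

theorem symplectic_coordinates:
  assumes fin: "finite (carrier G)" and cG: "card (carrier G) = 3 ^ 5" and cZ: "card (center G) = 3"
  shows "\<exists>v. (\<forall>x \<in> carrier G. \<forall>y \<in> carrier G. v (x \<otimes> y) = v x + v y) \<and>
    (\<forall>x \<in> carrier G. \<forall>y \<in> carrier G. form x y = omega (v x) (v y)) \<and>
    (\<forall>x \<in> carrier G. v x = 0 \<longleftrightarrow> x \<in> center G)"
proof -
  have Zsub: "center G \<subseteq> carrier G" by (auto simp: center_def)
  have "center G \<noteq> carrier G" using cG cZ by auto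
  then obtain x1 where x1: "x1 \<in> carrier G" "x1 \<notin> center G" using Zsub by blast
  obtain y1 where y1: "y1 \<in> carrier G" "form x1 y1 = 1" using hyperbolic_partner[OF x1] by blast
  obtain x2 where x2: "x2 \<in> carrier G" "x2 \<notin> center G" "form x1 x2 = 0" "form y1 x2 = 0"
    using orthogonal_noncentral[OF x1(1) y1 fin] cG cZ by auto
  obtain y where y: "y \<in> carrier G" "form x2 y = 1" using hyperbolic_partner[OF x2(1,2)] by blast
  define y2 where "y2 = y \<otimes> (pw x1 (- form y y1) \<otimes> pw y1 (- form x1 y))"
  have y2: "y2 \<in> carrier G" using y x1 y1 by (simp add: y2_def)
  have sw: "form y1 x1 = - 1" "form x2 x1 = 0" "form x2 y1 = 0" "form y1 y = - form y y1"
    using form_swap[of x1 y1] form_swap[of x1 x2] form_swap[of y1 x2] form_swap[of y y1] x1 y1 x2 y by simp_all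
  have g: "form x1 y2 = 0" "form y1 y2 = 0" "form x2 y2 = 1"
    using x1(1) y1 x2 y sw by (simp_all add: y2_def form_mult_right form_pw_right)
  have g': "form y2 x1 = 0" "form y2 y1 = 0" "form y2 x2 = - 1"
    using g form_swap[of x1 y2] form_swap[of y1 y2] form_swap[of x2 y2] x1 y1 x2 y2 by simp_all
  note gram = y1(2) x2(3,4) sw(1-3) g g'
  note cl = x1(1) y1(1) x2(1) y2
  define v where "v h = Vec (form h y1) (form x1 h) (form h y2) (form x2 h)" for h
  have v_mult: "v (h \<otimes> k) = v h + v k" if "h \<in> carrier G" "k \<in> carrier G" for h k
    using that cl by (simp add: v_def form_mult_left form_mult_right)
  define rep where "rep t = (case t of Vec a b c d \<Rightarrow> pw x1 a \<otimes> pw y1 b \<otimes> pw x2 c \<otimes> pw y2 d)" for t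
  have rep: "rep t \<in> carrier G" for t using cl by (cases t) (simp add: rep_def)
  have v_rep: "v (rep t) = t" for t
    using cl gram by (cases t) (simp add: rep_def v_def form_mult_left form_mult_right form_pw_left form_pw_right)
  define K where "K = {k \<in> carrier G. v k = 0}"
  have ZK: "center G \<subseteq> K"
  proof
    fix z assume z: "z \<in> center G"
    then have zc: "z \<in> carrier G" using Zsub by blast
    have "form z h = 0 \<and> form h z = 0" if "h \<in> carrier G" for h
      using z that zc center_iff form_swap[of z h] by simp
    then show "z \<in> K" using zc cl by (simp add: K_def v_def zero_vec_def zero_f3_def)
  qed
  have fK: "finite K" using fin by (simp add: K_def)
  have "inj_on (\<lambda>(t, k). rep t \<otimes> k) (UNIV \<times> K)"
  proof (rule inj_onI, clarify)
    fix t k t' k' assume a: "k \<in> K" "k' \<in> K" "rep t \<otimes> k = rep t' \<otimes> k'"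
    have k: "k \<in> carrier G" "v k = 0" "k' \<in> carrier G" "v k' = 0" using a by (simp_all add: K_def)
    have "v (rep t \<otimes> k) = t" "v (rep t' \<otimes> k') = t'" using v_mult[OF rep] k by (simp_all add: v_rep)
    then have "t = t'" using a(3) by simp
    then show "t = t' \<and> k = k'" using a(3) k rep by simp
  qed
  then have "card ((UNIV :: vec set) \<times> K) \<le> card (carrier G)"
    by (rule card_inj_on_le) (use rep fin in \<open>auto simp: K_def\<close>)
  then have "card K \<le> card (center G)" using cG cZ by (simp add: card_cartesian_product card_vec)
  then have K: "K = center G" using ZK fK by (metis card_seteq)
  have form_v: "form h k = omega (v h) (v k)" if h: "h \<in> carrier G" and k: "k \<in> carrier G" for h k
  proof -
    define r where "r = h \<otimes> inv (rep (v h))"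
    have rc: "r \<in> carrier G" using h rep by (simp add: r_def)
    have hr: "h = r \<otimes> rep (v h)" using h rep by (simp add: r_def m_assoc)
    have "v h = v r + v h" using v_mult[OF rc rep, of "v h"] v_rep hr by simp
    then have "v r = 0" by simp
    then have "r \<in> center G" using rc K K_def by blast
    then have "form r k = 0" using k center_iff by blast
    then have "form h k = form (rep (v h)) k"
      using form_mult_left[OF rc rep k, of "v h"] hr by simp
    moreover have "form (rep t) k = omega t (v k)" for t
    proof (cases t)
      case (Vec a b c d)
      have "form y1 k = - form k y1" "form y2 k = - form k y2" using form_swap k cl by blast+
      then show ?thesis using Vec cl k
        by (simp add: rep_def v_def form_mult_left form_pw_left algebra_simps)
    qed
    ultimately show ?thesis by simp
  qed
  have "v x = 0 \<longleftrightarrow> x \<in> center G" if "x \<in> carrier G" for x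
    using that K by (auto simp: K_def)
  then show ?thesis using v_mult form_v by blast
qed

end

text \<open>The powers of an element \<open>c\<close> of order three, with exponents in the field with three elements.\<close>

definition central_cube :: "('a, 'm) monoid_scheme \<Rightarrow> 'a \<Rightarrow> f3 \<Rightarrow> 'a" where
  "central_cube G c e = (case e of F0 \<Rightarrow> \<one>\<^bsub>G\<^esub> | F1 \<Rightarrow> c | F2 \<Rightarrow> c \<otimes>\<^bsub>G\<^esub> c)"

lemma (in group) subgroup_center: "subgroup (center G) G"
proof (rule subgroupI)
  show "inv a \<in> center G" if "a \<in> center G" for a
  proof -
    have a: "a \<in> carrier G" "\<And>g. g \<in> carrier G \<Longrightarrow> a \<otimes> g = g \<otimes> a" using that by (auto simp: center_def)
    have "inv a \<otimes> g = g \<otimes> inv a" if g: "g \<in> carrier G" for g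
    proof -
      have "inv a \<otimes> g = inv a \<otimes> (g \<otimes> a) \<otimes> inv a" using a(1) g by (simp add: m_assoc)
      also have "\<dots> = inv a \<otimes> (a \<otimes> g) \<otimes> inv a" using a(2)[OF g] by simp
      also have "\<dots> = g \<otimes> inv a" using a(1) g by (simp flip: m_assoc)
      finally show ?thesis .
    qed
    moreover have "inv a \<in> carrier G" using a(1) by simp
    ultimately show ?thesis unfolding center_def by blast
  qed
  show "a \<otimes> b \<in> center G" if "a \<in> center G" "b \<in> center G" for a b
  proof -
    have ab: "a \<in> carrier G" "b \<in> carrier G" "\<And>g. g \<in> carrier G \<Longrightarrow> a \<otimes> g = g \<otimes> a"
      "\<And>g. g \<in> carrier G \<Longrightarrow> b \<otimes> g = g \<otimes> b" using that by (auto simp: center_def)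
    have "a \<otimes> b \<otimes> g = g \<otimes> (a \<otimes> b)" if g: "g \<in> carrier G" for g
    proof -
      have "a \<otimes> b \<otimes> g = a \<otimes> g \<otimes> b" using ab(1,2) ab(4)[OF g] g by (simp add: m_assoc)
      also have "\<dots> = g \<otimes> (a \<otimes> b)" using ab(1,2) ab(3)[OF g] g by (simp add: m_assoc)
      finally show ?thesis .
    qed
    moreover have "a \<otimes> b \<in> carrier G" using ab(1,2) by simp
    ultimately show ?thesis unfolding center_def by blast
  qed
qed (auto simp: center_def intro!: exI[of _ \<one>])

lemma (in group) commutator_central:
  assumes comm: "comm_group (G Mod center G)" and x: "x \<in> carrier G" and y: "y \<in> carrier G"
  shows "\<exists>z \<in> center G. x \<otimes> y = y \<otimes> x \<otimes> z"
proof -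
  have sub: "subgroup (center G) G" by (rule subgroup_center)
  then have "center G \<lhd> G"
  proof (rule normalI)
    show "\<forall>x \<in> carrier G. center G #> x = x <# center G"
      by (auto simp: r_coset_def l_coset_def center_def)
  qed
  then interpret N: normal "center G" G .
  have "(center G #> x) <#> (center G #> y) = (center G #> y) <#> (center G #> x)"
    using comm_monoid.m_comm[OF comm_group.axioms(1)[OF comm], of "center G #> x" "center G #> y"] x y
    by (simp add: FactGroup_def RCOSETS_def) blast
  then have "center G #> (x \<otimes> y) = center G #> (y \<otimes> x)" using x y by (simp add: N.rcos_sum)
  then have "x \<otimes> y \<in> center G #> (y \<otimes> x)" using rcos_self[of "x \<otimes> y", OF _ sub] x y by simp
  then obtain z where z: "z \<in> center G" "x \<otimes> y = z \<otimes> (y \<otimes> x)" by (auto simp: r_coset_def)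
  moreover have "y \<otimes> x \<in> carrier G" using x y by simp
  ultimately have "x \<otimes> y = y \<otimes> x \<otimes> z" unfolding center_def by auto
  then show ?thesis using z(1) by blast
qed

lemma E2_symplectic_coordinates:
  assumes "is_E2 E"
  shows "group E" "finite (carrier E)" "card (carrier E) = 3 ^ 5"
    "\<And>x. x \<in> carrier E \<Longrightarrow> x \<otimes>\<^bsub>E\<^esub> x \<otimes>\<^bsub>E\<^esub> x = \<one>\<^bsub>E\<^esub>"
    "\<exists>cp v. inj cp \<and> (\<forall>e. cp e \<in> center E) \<and> (\<forall>d e. cp (d + e) = cp d \<otimes>\<^bsub>E\<^esub> cp e) \<and>
      (\<forall>x \<in> carrier E. \<forall>y \<in> carrier E. v (x \<otimes>\<^bsub>E\<^esub> y) = v x + v y) \<and>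
      (\<forall>x \<in> carrier E. \<forall>y \<in> carrier E. x \<otimes>\<^bsub>E\<^esub> y = y \<otimes>\<^bsub>E\<^esub> x \<otimes>\<^bsub>E\<^esub> cp (omega (v x) (v y))) \<and>
      (\<forall>x \<in> carrier E. v x = 0 \<longleftrightarrow> x \<in> center E)"
proof -
  have E: "group E" "card (center E) = 3" "comm_group (E Mod center E)" and o: "order E = 3 ^ 5"
    and ex: "group_exponent E = 3"
    using assms by (auto simp: is_E2_def extraspecial_def elementary_abelian_def)
  show "group E" by fact
  show cE: "card (carrier E) = 3 ^ 5" using o by (simp add: order_def)
  show fin: "finite (carrier E)" using cE by (intro card_ge_0_finite) simp
  interpret group E by fact
  have "order E > 0 \<and> (\<forall>x \<in> carrier E. x [^]\<^bsub>E\<^esub> order E = \<one>\<^bsub>E\<^esub>)"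
    using pow_order_eq_1 unfolding o by simp
  then have "\<exists>m::nat. m > 0 \<and> (\<forall>x \<in> carrier E. x [^]\<^bsub>E\<^esub> m = \<one>\<^bsub>E\<^esub>)" by blast
  from LeastI_ex[OF this] have "\<forall>x \<in> carrier E. x [^]\<^bsub>E\<^esub> (3::nat) = \<one>\<^bsub>E\<^esub>"
    using ex unfolding group_exponent_def by simp
  then show cube: "x \<otimes>\<^bsub>E\<^esub> x \<otimes>\<^bsub>E\<^esub> x = \<one>\<^bsub>E\<^esub>" if "x \<in> carrier E" for x
    using that by (force simp: numeral_3_eq_3)
  have sub: "subgroup (center E) E" by (rule subgroup_center)
  have "center E \<noteq> {\<one>\<^bsub>E\<^esub>}" using E(2) by auto
  then obtain c where c: "c \<in> center E" "c \<noteq> \<one>\<^bsub>E\<^esub>" using subgroup.one_closed[OF sub] by blast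
  have cc: "c \<in> carrier E" using c subgroup.mem_carrier[OF sub] by blast
  define cp where "cp = central_cube E c"
  have cp_add: "cp (d + e) = cp d \<otimes>\<^bsub>E\<^esub> cp e" for d e
    using cc cube[OF cc] by (cases d; cases e) (simp_all add: cp_def central_cube_def m_assoc flip: m_assoc)
  have cpZ: "cp e \<in> center E" for e
    using c subgroup.one_closed[OF sub] subgroup.m_closed[OF sub] by (cases e) (simp_all add: cp_def central_cube_def)
  have cpc: "cp e \<in> carrier E" for e using cpZ subgroup.mem_carrier[OF sub] by blast
  have inj: "inj cp"
  proof (rule injI)
    fix d e assume "cp d = cp e"
    moreover have "c \<otimes>\<^bsub>E\<^esub> c \<noteq> \<one>\<^bsub>E\<^esub>" using cube[OF cc] c(2) cc by auto
    moreover have "c \<otimes>\<^bsub>E\<^esub> c \<noteq> c" using c(2) cc by simp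
    ultimately show "d = e" using c(2) by (cases d; cases e) (auto simp: cp_def central_cube_def)
  qed
  have "card (range cp) = 3" using inj by (simp add: card_image card_f3)
  moreover have "finite (center E)" using fin subgroup.subset[OF sub] by (rule finite_subset[rotated])
  ultimately have range: "range cp = center E" using cpZ E(2) by (intro card_subset_eq) auto
  have "\<exists>e. x \<otimes>\<^bsub>E\<^esub> y = y \<otimes>\<^bsub>E\<^esub> x \<otimes>\<^bsub>E\<^esub> cp e" if "x \<in> carrier E" "y \<in> carrier E" for x y
    using commutator_central[OF E(3) that] unfolding range[symmetric] by blast
  then obtain form where form: "\<And>x y. x \<in> carrier E \<Longrightarrow> y \<in> carrier E \<Longrightarrow>
      x \<otimes>\<^bsub>E\<^esub> y = y \<otimes>\<^bsub>E\<^esub> x \<otimes>\<^bsub>E\<^esub> cp (form x y)" by metis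
  interpret central_form E cp form
  proof
    show "cp e \<otimes>\<^bsub>E\<^esub> x = x \<otimes>\<^bsub>E\<^esub> cp e" if "x \<in> carrier E" for e x
      using cpZ[of e] that by (simp add: center_def)
  qed (rule cpc cp_add inj form; assumption)+
  obtain v where v: "\<forall>x \<in> carrier E. \<forall>y \<in> carrier E. v (x \<otimes>\<^bsub>E\<^esub> y) = v x + v y"
    "\<forall>x \<in> carrier E. \<forall>y \<in> carrier E. form x y = omega (v x) (v y)"
    "\<forall>x \<in> carrier E. v x = 0 \<longleftrightarrow> x \<in> center E"
    using symplectic_coordinates[OF fin cE E(2)] by blast
  moreover have "x \<otimes>\<^bsub>E\<^esub> y = y \<otimes>\<^bsub>E\<^esub> x \<otimes>\<^bsub>E\<^esub> cp (omega (v x) (v y))" if "x \<in> carrier E" "y \<in> carrier E" for x y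
    using form[OF that] v(2) that by metis
  ultimately show "\<exists>cp v. inj cp \<and> (\<forall>e. cp e \<in> center E) \<and> (\<forall>d e. cp (d + e) = cp d \<otimes>\<^bsub>E\<^esub> cp e) \<and>
      (\<forall>x \<in> carrier E. \<forall>y \<in> carrier E. v (x \<otimes>\<^bsub>E\<^esub> y) = v x + v y) \<and>
      (\<forall>x \<in> carrier E. \<forall>y \<in> carrier E. x \<otimes>\<^bsub>E\<^esub> y = y \<otimes>\<^bsub>E\<^esub> x \<otimes>\<^bsub>E\<^esub> cp (omega (v x) (v y))) \<and>
      (\<forall>x \<in> carrier E. v x = 0 \<longleftrightarrow> x \<in> center E)"
    using inj cpZ cp_add by blast
qed

section \<open>The associated abelian group\<close>

lemma C3_power:
  shows "comm_group (C3_power r)" "card (carrier (C3_power r)) = 3 ^ r"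
    "\<And>x. x \<in> carrier (C3_power r) \<Longrightarrow> x \<otimes>\<^bsub>C3_power r\<^esub> x \<otimes>\<^bsub>C3_power r\<^esub> x = \<one>\<^bsub>C3_power r\<^esub>"
proof -
  show "comm_group (C3_power r)"
    unfolding C3_power_def
  proof (rule group.group_comm_groupI)
    fix x y :: "nat \<Rightarrow> int"
    show "x \<otimes>\<^bsub>product_group {..<r} (\<lambda>_. integer_mod_group 3)\<^esub> y =
        y \<otimes>\<^bsub>product_group {..<r} (\<lambda>_. integer_mod_group 3)\<^esub> x" by (simp add: add.commute)
  qed simp
  show "card (carrier (C3_power r)) = 3 ^ r"
    unfolding C3_power_def by (simp add: card_PiE carrier_integer_mod_group)
  show "x \<otimes>\<^bsub>C3_power r\<^esub> x \<otimes>\<^bsub>C3_power r\<^esub> x = \<one>\<^bsub>C3_power r\<^esub>" for x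
    unfolding C3_power_def by (auto simp: integer_mod_group_def fun_eq_iff mod_simps)
qed

text \<open>
  A group of exponent three with a homomorphism \<open>v\<close> to the symplectic space that describes its
  commutators. The kernel of \<open>v\<close> may be larger than \<open>range cp\<close>, as it is for the direct product
  of \<open>E\<close> with an elementary abelian group.
\<close>

locale symplectic_group = group +
  fixes cp :: "f3 \<Rightarrow> 'a" and v :: "'a \<Rightarrow> vec"
  assumes cp_closed [simp]: "cp e \<in> carrier G"
    and cp_add: "cp (d + e) = cp d \<otimes> cp e" and cp_inj: "inj cp"
    and cp_central: "x \<in> carrier G \<Longrightarrow> cp e \<otimes> x = x \<otimes> cp e"
    and v_mult [simp]: "x \<in> carrier G \<Longrightarrow> y \<in> carrier G \<Longrightarrow> v (x \<otimes> y) = v x + v y"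
    and v_cp [simp]: "v (cp e) = 0"
    and commutation: "x \<in> carrier G \<Longrightarrow> y \<in> carrier G \<Longrightarrow> x \<otimes> y = y \<otimes> x \<otimes> cp (omega (v x) (v y))"
    and cube: "x \<in> carrier G \<Longrightarrow> x \<otimes> x \<otimes> x = \<one>"
begin

text \<open>
  As \<open>2 = - 1\<close> in the field with three elements, the factor \<open>cp (\<omega> (v x) (v y))\<close> is a square
  root of the inverse of the commutator of \<open>x\<close> and \<open>y\<close>, which makes the operation commutative.
\<close>

definition baer :: "'a monoid" where
  "baer = \<lparr>carrier = carrier G, monoid.mult = \<lambda>x y. x \<otimes> y \<otimes> cp (omega (v x) (v y)), one = \<one>\<rparr>"

lemma baer_simps [simp]:
  "carrier baer = carrier G" "\<one>\<^bsub>baer\<^esub> = \<one>" "x \<otimes>\<^bsub>baer\<^esub> y = x \<otimes> y \<otimes> cp (omega (v x) (v y))"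
  by (simp_all add: baer_def)

lemma cp_0 [simp]: "cp 0 = \<one>"
  using cp_add[of 0 0] cp_closed[of 0] by (metis add.right_neutral r_cancel_one')

lemma v_1 [simp]: "v \<one> = 0"
  using v_cp[of 0] by simp

lemma baer_comm_group: "comm_group baer"
proof (rule comm_groupI)
  fix x y z assume xyz: "x \<in> carrier baer" "y \<in> carrier baer" "z \<in> carrier baer"
  then have x [simp]: "x \<in> carrier G" "y \<in> carrier G" "z \<in> carrier G" by simp_all
  show "x \<otimes>\<^bsub>baer\<^esub> y \<otimes>\<^bsub>baer\<^esub> z = x \<otimes>\<^bsub>baer\<^esub> (y \<otimes>\<^bsub>baer\<^esub> z)"
  proof -
    have "x \<otimes>\<^bsub>baer\<^esub> y \<otimes>\<^bsub>baer\<^esub> z =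
        x \<otimes> y \<otimes> z \<otimes> cp (omega (v x) (v y) + (omega (v x) (v z) + omega (v y) (v z)))"
      by (simp add: omega_add_left cp_add m_assoc cp_central[of z])
    moreover have "x \<otimes>\<^bsub>baer\<^esub> (y \<otimes>\<^bsub>baer\<^esub> z) =
        x \<otimes> y \<otimes> z \<otimes> cp (omega (v y) (v z) + (omega (v x) (v y) + omega (v x) (v z)))"
      by (simp add: omega_add_right cp_add m_assoc)
    ultimately show ?thesis by (simp only: add.assoc add.left_commute add.commute)
  qed
next
  fix x y assume "x \<in> carrier baer" "y \<in> carrier baer"
  then have x [simp]: "x \<in> carrier G" "y \<in> carrier G" by simp_all
  have "x \<otimes> y \<otimes> cp (omega (v x) (v y)) = y \<otimes> x \<otimes> (cp (omega (v x) (v y)) \<otimes> cp (omega (v x) (v y)))"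
    using commutation[of x y] by (simp add: m_assoc)
  also have "\<dots> = y \<otimes> x \<otimes> cp (omega (v y) (v x))"
    by (simp only: cp_add[symmetric] f3_double omega_swap[of "v y" "v x"])
  finally show "x \<otimes>\<^bsub>baer\<^esub> y = y \<otimes>\<^bsub>baer\<^esub> x" by simp
next
  fix x assume "x \<in> carrier baer"
  then have x: "x \<in> carrier G" by simp
  have "v (inv x) + v x = 0" using v_mult[of "inv x" x] x by simp
  then have "v (inv x) = - v x" by (simp add: eq_neg_iff_add_eq_0)
  then have "inv x \<otimes>\<^bsub>baer\<^esub> x = \<one>\<^bsub>baer\<^esub>" using x by (simp add: omega_minus_left)
  then show "\<exists>y \<in> carrier baer. y \<otimes>\<^bsub>baer\<^esub> x = \<one>\<^bsub>baer\<^esub>" using x by (intro bexI[of _ "inv x"]) auto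
qed simp_all

text \<open>
  The ordered product is the abelian product, corrected by the value of the ordering. The other
  two claims are needed for the induction.
\<close>

lemma foldr_mult_baer:
  assumes "distinct xs" "g \<in> set xs \<rightarrow> carrier G"
  shows "foldr (\<otimes>) (map g xs) \<one> = finprod baer g (set xs) \<otimes> cp (- order_value (map (v \<circ> g) xs)) \<and>
    v (foldr (\<otimes>) (map g xs) \<one>) = sum_list (map (v \<circ> g) xs) \<and> foldr (\<otimes>) (map g xs) \<one> \<in> carrier G"
  using assms
proof (induction xs)
  case Nil
  interpret B: comm_group baer by (rule baer_comm_group)
  show ?case using B.finprod_empty[of g] by simp
next
  case (Cons x xs)
  interpret B: comm_group baer by (rule baer_comm_group)
  define p P e where "p = foldr (\<otimes>) (map g xs) \<one>" and "P = finprod baer g (set xs)"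
    and "e = order_value (map (v \<circ> g) xs)"
  have gx: "g x \<in> carrier G" and gxs: "g \<in> set xs \<rightarrow> carrier G" using Cons.prems by auto
  then have IH: "p = P \<otimes> cp (- e)" "v p = sum_list (map (v \<circ> g) xs)" "p \<in> carrier G"
    using Cons unfolding p_def P_def e_def distinct.simps by blast+
  have P: "P \<in> carrier G" using B.finprod_closed[of g "set xs"] gxs by (simp add: P_def)
  have vP: "v P = v p" using IH(1) P by simp
  have "finprod baer g (set (x # xs)) = g x \<otimes>\<^bsub>baer\<^esub> P"
    using Cons.prems gx gxs unfolding P_def list.set by (intro B.finprod_insert) auto
  moreover have "g x \<otimes> p = g x \<otimes>\<^bsub>baer\<^esub> P \<otimes> cp (- (omega (v (g x)) (v P) + e))"
  proof -
    have "cp (omega (v (g x)) (v P)) \<otimes> cp (- (omega (v (g x)) (v P) + e)) = cp (- e)"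
      by (simp flip: cp_add)
    then show ?thesis using gx P unfolding IH(1) by (simp add: m_assoc)
  qed
  moreover have "sum_list (map (v \<circ> g) xs) = v P" using vP IH(2) by simp
  moreover have "v (g x \<otimes> p) = v (g x) + v P" using vP IH(3) gx by simp
  ultimately show ?case using IH(3) gx P unfolding e_def p_def comp_def by simp
qed

theorem no_free_sequence:
  assumes order: "card (carrier G) = 3 ^ Suc n"
    and S: "sequence_over G S" "product_one_free G S" "size S = 2 * Suc n + 1"
    and few: "size (filter_mset (\<lambda>x. v x \<noteq> 0) S) \<le> 12"
  shows False
proof -
  interpret B: comm_group baer by (rule baer_comm_group)
  obtain xs where xs: "mset xs = S" by (metis ex_mset)
  \<comment> \<open>The positions of a list with the given terms serve as index set.\<close>
  define I g where "I = {..<length xs}" and "g = nth xs"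
  have gc: "g i \<in> carrier G" if "i \<in> I" for i
    using that S(1) xs by (auto simp: I_def g_def sequence_over_def)
  have sub: "image_mset g (mset_set K) \<subseteq># S" if "K \<subseteq> I" for K
  proof -
    have "image_mset g (mset_set I) = mset xs"
      unfolding I_def g_def mset_set_upto_eq_mset_upto mset_map[symmetric] map_nth ..
    then show ?thesis
      using image_mset_subseteq_mono[OF subset_imp_msubset_mset_set[OF that], of g] xs by (simp add: I_def)
  qed
  interpret free_sequence baer cp v I g n
  proof
    show "finite (carrier baer)" using order by (intro card_ge_0_finite) simp
    show "card (carrier baer) = 3 ^ Suc n" using order by simp
    show "x \<otimes>\<^bsub>baer\<^esub> x \<otimes>\<^bsub>baer\<^esub> x = \<one>\<^bsub>baer\<^esub>" if "x \<in> carrier baer" for x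
      using that cube by (simp add: omega_add_left)
    show "cp (d + e) = cp d \<otimes>\<^bsub>baer\<^esub> cp e" for d e by (simp add: cp_add)
    show "v (x \<otimes>\<^bsub>baer\<^esub> y) = v x + v y" if "x \<in> carrier baer" "y \<in> carrier baer" for x y using that by simp
    show "card I = 2 * Suc n + 1" using S(3) xs by (auto simp: I_def)
    show "card {i \<in> I. v (g i) \<noteq> 0} \<le> 12"
    proof -
      have "card {i \<in> I. v (g i) \<noteq> 0} = length (filter (\<lambda>x. v x \<noteq> 0) xs)"
        by (simp add: length_filter_conv_card I_def g_def)
      also have "\<dots> = size (filter_mset (\<lambda>x. v x \<noteq> 0) S)" using xs by (metis mset_filter size_mset)
      finally show ?thesis using few by simp
    qed
    show "finprod baer g K \<noteq> cp e" if K: "K \<subseteq> I" "K \<noteq> {}" "e \<in> attained (v \<circ> g) K" for K e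
    proof
      assume eq: "finprod baer g K = cp e"
      obtain ys where ys: "distinct ys" "set ys = K" "e = order_value (map (v \<circ> g) ys)"
        using K(3) by (auto simp: attained_def)
      have "foldr (\<otimes>) (map g ys) \<one> = cp e \<otimes> cp (- e)"
        using foldr_mult_baer[OF ys(1), of g] gc K(1) ys(2,3) eq by auto
      also have "\<dots> = \<one>" by (simp flip: cp_add)
      finally have "product_one G (mset (map g ys))" unfolding product_one_def by blast
      moreover have "mset (map g ys) = image_mset g (mset_set K)" using mset_set_set[OF ys(1)] ys(2) by simp
      moreover have "mset (map g ys) \<noteq> {#}" using ys(2) K(2) by auto
      ultimately show False using sub[OF K(1)] S(2) unfolding product_one_free_def by metis
    qed
  qed (auto simp: I_def gc cp_inj intro: gc)
  show False by (rule contradiction)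
qed

end

section \<open>The theorem\<close>

theorem theorem1p1:
  fixes E :: "('a, 'm) monoid_scheme"
    and G :: "('a \<times> (nat \<Rightarrow> int)) monoid"
    and r :: nat
  assumes "is_E2 E"
    and "r \<ge> 1"
    and "G = E \<times>\<times> C3_power r"
  shows "\<not> (\<exists>S. sequence_over G S \<and> product_one_free G S \<and>
    size S = 2 * r + 11 \<and> size (filter_mset (\<lambda>g. g \<in> center G) S) = 2 * r - 1)"
proof
  assume "\<exists>S. sequence_over G S \<and> product_one_free G S \<and>
    size S = 2 * r + 11 \<and> size (filter_mset (\<lambda>g. g \<in> center G) S) = 2 * r - 1"
  then obtain S where S: "sequence_over G S" "product_one_free G S" "size S = 2 * r + 11"
    "size (filter_mset (\<lambda>g. g \<in> center G) S) = 2 * r - 1" by blast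
  let ?C = "C3_power r"
  note E = E2_symplectic_coordinates[OF assms(1)]
  interpret E: group E by (rule E(1))
  interpret C: comm_group ?C by (rule C3_power(1))
  obtain cp :: "f3 \<Rightarrow> 'a" and v :: "'a \<Rightarrow> vec" where inj: "inj cp" and cpZ: "\<And>e. cp e \<in> center E"
    and cp_add: "\<And>d e. cp (d + e) = cp d \<otimes>\<^bsub>E\<^esub> cp e"
    and v_mult: "\<And>x y. x \<in> carrier E \<Longrightarrow> y \<in> carrier E \<Longrightarrow> v (x \<otimes>\<^bsub>E\<^esub> y) = v x + v y"
    and comm: "\<And>x y. x \<in> carrier E \<Longrightarrow> y \<in> carrier E \<Longrightarrow> x \<otimes>\<^bsub>E\<^esub> y = y \<otimes>\<^bsub>E\<^esub> x \<otimes>\<^bsub>E\<^esub> cp (omega (v x) (v y))"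
    and v0: "\<And>x. x \<in> carrier E \<Longrightarrow> v x = 0 \<longleftrightarrow> x \<in> center E"
    using E(5) by blast
  have cpc: "cp e \<in> carrier E" for e using cpZ[of e] by (simp add: center_def)
  have cp_comm: "cp e \<otimes>\<^bsub>E\<^esub> x = x \<otimes>\<^bsub>E\<^esub> cp e" if "x \<in> carrier E" for e x
    using cpZ[of e] that by (simp add: center_def)
  have G: "carrier G = carrier E \<times> carrier ?C" "\<one>\<^bsub>G\<^esub> = (\<one>\<^bsub>E\<^esub>, \<one>\<^bsub>?C\<^esub>)"
    "\<And>x y. x \<otimes>\<^bsub>G\<^esub> y = (fst x \<otimes>\<^bsub>E\<^esub> fst y, snd x \<otimes>\<^bsub>?C\<^esub> snd y)"
    by (simp_all add: assms(3) DirProd_def case_prod_beta)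
  have center_G: "x \<in> center G \<longleftrightarrow> v (fst x) = 0" if x: "x \<in> carrier G" for x
  proof -
    have "x \<in> center G \<longleftrightarrow> fst x \<in> center E"
      using x C.m_comm by (auto simp: center_def assms(3) DirProd_def)
    then show ?thesis using x v0[of "fst x"] by (auto simp: assms(3) DirProd_def)
  qed
  interpret symplectic_group G "\<lambda>e. (cp e, \<one>\<^bsub>?C\<^esub>)" "v \<circ> fst"
  proof (intro symplectic_group.intro symplectic_group_axioms.intro)
    show "group G" unfolding assms(3) by (rule DirProd_group) (rule E(1), rule C.is_group)
    show "inj (\<lambda>e. (cp e, \<one>\<^bsub>?C\<^esub>))" using inj by (simp add: inj_def)
    fix d e :: f3
    show "(cp e, \<one>\<^bsub>?C\<^esub>) \<in> carrier G" using cpc by (simp add: G)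
    show "(cp (d + e), \<one>\<^bsub>?C\<^esub>) = (cp d, \<one>\<^bsub>?C\<^esub>) \<otimes>\<^bsub>G\<^esub> (cp e, \<one>\<^bsub>?C\<^esub>)" by (simp add: G cp_add)
    show "(v \<circ> fst) (cp e, \<one>\<^bsub>?C\<^esub>) = 0" using v0[OF cpc] cpZ by simp
    fix x assume "x \<in> carrier G"
    then have x: "fst x \<in> carrier E" "snd x \<in> carrier ?C" by (auto simp: G)
    show "(cp e, \<one>\<^bsub>?C\<^esub>) \<otimes>\<^bsub>G\<^esub> x = x \<otimes>\<^bsub>G\<^esub> (cp e, \<one>\<^bsub>?C\<^esub>)" using x cp_comm[OF x(1), of e] by (simp add: G)
    show "x \<otimes>\<^bsub>G\<^esub> x \<otimes>\<^bsub>G\<^esub> x = \<one>\<^bsub>G\<^esub>" using E(4)[OF x(1)] C3_power(3)[OF x(2)] by (simp add: G)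
    fix y assume "y \<in> carrier G"
    then have y: "fst y \<in> carrier E" "snd y \<in> carrier ?C" by (auto simp: G)
    show "(v \<circ> fst) (x \<otimes>\<^bsub>G\<^esub> y) = (v \<circ> fst) x + (v \<circ> fst) y" using v_mult x y by (simp add: G)
    have "snd x \<otimes>\<^bsub>?C\<^esub> snd y = snd y \<otimes>\<^bsub>?C\<^esub> snd x \<otimes>\<^bsub>?C\<^esub> \<one>\<^bsub>?C\<^esub>"
      using C.m_comm[OF x(2) y(2)] C.m_closed[OF y(2) x(2)] by (metis C.r_one)
    then show "x \<otimes>\<^bsub>G\<^esub> y = y \<otimes>\<^bsub>G\<^esub> x \<otimes>\<^bsub>G\<^esub> (cp (omega ((v \<circ> fst) x) ((v \<circ> fst) y)), \<one>\<^bsub>?C\<^esub>)"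
      unfolding G using comm[OF x(1) y(1)] by (metis comp_apply fst_conv snd_conv)
  qed
  show False
  proof (rule no_free_sequence)
    show "card (carrier G) = 3 ^ Suc (r + 4)"
      using E(3) C3_power(2) by (simp add: assms(3) DirProd_def card_cartesian_product power_add)
    show "size S = 2 * Suc (r + 4) + 1" using S(3) by simp
    have "filter_mset (\<lambda>x. (v \<circ> fst) x \<noteq> 0) S = filter_mset (\<lambda>x. \<not> x \<in> center G) S"
      using S(1) center_G by (intro filter_mset_cong) (auto simp: sequence_over_def)
    moreover have "size S = size (filter_mset (\<lambda>x. x \<in> center G) S) + size (filter_mset (\<lambda>x. \<not> x \<in> center G) S)"
      by (metis multiset_partition size_union)
    ultimately show "size (filter_mset (\<lambda>x. (v \<circ> fst) x \<noteq> 0) S) \<le> 12"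
      using S(3,4) assms(2) by simp
  qed (rule S(1), rule S(2))
qed

end
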